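(* Let $\nu>-1$ and $A_n=\alpha_{\nu,1}^2\eta_{2n+2}(\nu)-\eta_{2n}(\nu)$ for $n\in\mathbb{N}$. Then for every $n\in\mathbb{N}$ and all $0<|x|<\alpha_{\nu,1}$, $$\frac{R_{2n}(x)+\frac43(\nu+1)a\,x^{2n+2}}{\alpha_{\nu,1}^2-x^2}<-\frac{2(\nu+1)}{3x}\cdot\frac{\mathcal{D}_\nu'(x)}{\mathcal{D}_\nu(x)}<\frac{R_{2n}(x)+\frac43(\nu+1)b\,x^{2n+2}}{\alpha_{\nu,1}^2-x^2},$$ where $$a=\frac{1}{\alpha_{\nu,1}^{2n+2}}\left(1-\frac{3\alpha_{\nu,1}^2}{4(\nu+1)}-\sum_{m=1}^nA_m\alpha_{\nu,1}^{2m}\right),\quad b=A_{n+1},\quad R_{2n}(x)=\alpha_{\nu,1}^2+\frac{4(\nu+1)}{3}\sum_{m=1}^nA_mx^{2m}.$$ Moreover, the constants $a$ and $b$ are sharp.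
   Context: $J_\nu$ is the Bessel function of the first kind; $\mathbb{N}=\{1,2,\dots\}$. The Dini function is $d_\nu(z)=(1-\nu)J_\nu(z)+zJ_\nu'(z)=J_\nu(z)-zJ_{\nu+1}(z)$; $\alpha_{\nu,n}$ is its $n$th positive zero (in increasing order); its normalization is $\mathcal{D}_\nu(z)=2^\nu\Gamma(\nu+1)z^{-\nu}d_\nu(z)$, an even entire function with $\mathcal{D}_\nu(0)=1$. The Rayleigh functions are $\eta_{2m}(\nu)=\sum_{n\ge1}\alpha_{\nu,n}^{-2m}$ for $m\in\mathbb{N}$. Sharpness means that $a$ cannot be replaced by a larger constant in the left inequality and $b$ cannot be replaced by a smaller constant in the right inequality, if these are to hold for all $0<|x|<\alpha_{\nu,1}$. *)

theory Defs
  imports "HOL-Analysis.Analysis"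
begin

text \<open>
  Bessel function of the first kind on the positive real axis. The reciprocal Gamma function
  supplies the usual convention that \<open>1 / \<Gamma>\<close> vanishes at the poles of \<open>\<Gamma>\<close>.
\<close>

definition bessel_J :: "real \<Rightarrow> real \<Rightarrow> real" where
  "bessel_J \<nu> x =
     (\<Sum>k. (- 1) ^ k / fact k * rGamma (\<nu> + real k + 1) * (x / 2) powr (2 * real k + \<nu>))"

definition dini :: "real \<Rightarrow> real \<Rightarrow> real" where
  "dini \<nu> x = (1 - \<nu>) * bessel_J \<nu> x + x * deriv (bessel_J \<nu>) x"

text \<open>
  The entire function \<open>2\<^sup>\<nu> \<Gamma>(\<nu> + 1) z\<^sup>-\<^sup>\<nu> d\<^sub>\<nu>(z)\<close>, restricted to the real line. Since it is even,
  its value at a negative \<open>x\<close> is the one at \<open>\<bar>x\<bar>\<close>, where the real powers are unambiguous;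
  the value at \<open>0\<close> fills the removable singularity.
\<close>

definition dini_normalized :: "real \<Rightarrow> real \<Rightarrow> real" where
  "dini_normalized \<nu> x =
     (if x = 0 then 1 else 2 powr \<nu> * Gamma (\<nu> + 1) * \<bar>x\<bar> powr (- \<nu>) * dini \<nu> \<bar>x\<bar>)"

text \<open>
  The \<open>n\<close>th positive zero, counted from \<open>n = 1\<close>. As infinite sets have cardinality \<open>0\<close>,
  a cardinality \<open>n \<ge> 1\<close> includes finiteness.
\<close>

definition dini_zero :: "real \<Rightarrow> nat \<Rightarrow> real" where
  "dini_zero \<nu> n =
     (THE x. 0 < x \<and> dini \<nu> x = 0 \<and> card {y. 0 < y \<and> y \<le> x \<and> dini \<nu> y = 0} = n)"

text \<open>The argument \<open>k\<close> is the exponent itself, so that \<open>\<eta>\<^sub>2\<^sub>m(\<nu>)\<close> is \<open>dini_rayleigh (2 * m) \<nu>\<close>.\<close>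

definition dini_rayleigh :: "nat \<Rightarrow> real \<Rightarrow> real" where
  "dini_rayleigh k \<nu> = (\<Sum>\<^sub>\<infinity>n\<in>{1..}. 1 / dini_zero \<nu> n ^ k)"

definition dini_A :: "real \<Rightarrow> nat \<Rightarrow> real" where
  "dini_A \<nu> n =
     (dini_zero \<nu> 1)\<^sup>2 * dini_rayleigh (2 * n + 2) \<nu> - dini_rayleigh (2 * n) \<nu>"

text \<open>\<open>R\<^sub>2\<^sub>n(x)\<close> is \<open>dini_R \<nu> n x\<close>.\<close>

definition dini_R :: "real \<Rightarrow> nat \<Rightarrow> real \<Rightarrow> real" where
  "dini_R \<nu> n x =
     (dini_zero \<nu> 1)\<^sup>2 + 4 * (\<nu> + 1) / 3 * (\<Sum>m=1..n. dini_A \<nu> m * x ^ (2 * m))"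

definition dini_a :: "real \<Rightarrow> nat \<Rightarrow> real" where
  "dini_a \<nu> n =
     1 / dini_zero \<nu> 1 ^ (2 * n + 2) *
       (1 - 3 * (dini_zero \<nu> 1)\<^sup>2 / (4 * (\<nu> + 1))
          - (\<Sum>m=1..n. dini_A \<nu> m * dini_zero \<nu> 1 ^ (2 * m)))"

definition dini_b :: "real \<Rightarrow> nat \<Rightarrow> real" where
  "dini_b \<nu> n = dini_A \<nu> (n + 1)"

end

theory Submission
  imports Defs "HOL-Complex_Analysis.Complex_Analysis"
begin

text \<open>
  With \<open>t = x\<^sup>2\<close>, \<open>w\<^sub>k = \<alpha>\<^sub>k\<^sup>2\<close> and \<open>\<D>\<^sub>\<nu>(x) = F(t)\<close>, the middle term is
  \<open>4 (\<nu> + 1) / 3 * G(t)\<close> for \<open>G = - F' / F\<close>. The entire function \<open>F\<close> is of exponential type zero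
  and all its zeros \<open>w\<^sub>k\<close> are positive and simple, so \<open>G(t) = \<Sum>\<^sub>k 1 / (w\<^sub>k - t)\<close>. Summing
  the finite geometric expansion of \<open>(w\<^sub>1 - t) / (w\<^sub>k - t)\<close> over \<open>k\<close> gives
  \<open>(w\<^sub>1 - t) G(t) = w\<^sub>1 \<eta>\<^sub>2 + (\<Sum>m=1..n. A\<^sub>m t\<^sup>m) - t\<^sup>n\<^sup>+\<^sup>1 S(t)\<close> with
  \<open>S(t) = \<Sum>\<^sub>k (w\<^sub>k - w\<^sub>1) / (w\<^sub>k\<^sup>n\<^sup>+\<^sup>1 (w\<^sub>k - t))\<close> and \<open>w\<^sub>1 \<eta>\<^sub>2 = 3 w\<^sub>1 / (4 (\<nu> + 1))\<close>. The function \<open>S\<close>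
  is strictly increasing and continuous on \<open>[0, w\<^sub>1]\<close>, and \<open>b = - S(0)\<close>, \<open>a = - S(w\<^sub>1)\<close>.
\<close>

section \<open>Logarithmic derivatives of entire functions of exponential type zero\<close>

text \<open>The Moebius map w / (2A - w) fixes 0 and takes the half plane Re w < A into the unit
  disc, because |2A - w|^2 - |w|^2 = 4A (A - Re w). The Schwarz lemma applies to its composition
  with \<open>g\<close> rescaled to the unit disc, and the resulting inequality is solved for
  \<open>norm (g z)\<close>.\<close>

lemma Borel_Caratheodory_ball:
  fixes g :: "complex \<Rightarrow> complex"
  assumes holg: "g holomorphic_on ball 0 R" and g0: "g 0 = 0"
    and re: "\<And>z. norm z < R \<Longrightarrow> Re (g z) < A" and z: "norm z < R"
  shows "norm (g z) \<le> 2 * A * norm z / (R - norm z)"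
proof -
  have R: "R > 0" using z norm_ge_zero[of z] by linarith
  have A: "A > 0" using re[of 0] g0 R by simp
  define f where "f = (\<lambda>\<zeta>. g (of_real R * \<zeta>) / (of_real (2 * A) - g (of_real R * \<zeta>)))"
  have inb: "norm (of_real R * \<zeta>) < R" if "norm \<zeta> < 1" for \<zeta> :: complex
    using that R by (simp add: norm_mult)
  have lt: "norm (g w) < norm (of_real (2 * A) - g w)" if "norm w < R" for w
  proof -
    have "(norm (of_real (2 * A) - g w))\<^sup>2 - (norm (g w))\<^sup>2 = 4 * A * (A - Re (g w))"
      unfolding cmod_power2 by (simp add: power2_eq_square algebra_simps)
    moreover have "4 * A * (A - Re (g w)) > 0" using A re[OF that] by simp
    ultimately have "(norm (g w))\<^sup>2 < (norm (of_real (2 * A) - g w))\<^sup>2" by linarith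
    then show ?thesis by (rule power2_less_imp_less) simp
  qed
  have nz: "of_real (2 * A) - g w \<noteq> 0" if "norm w < R" for w
    using lt[OF that] norm_ge_zero[of "g w"] by (metis norm_zero not_less)
  have holc: "(\<lambda>\<zeta>. g (of_real R * \<zeta>)) holomorphic_on ball 0 1"
  proof -
    have "(g \<circ> (\<lambda>\<zeta>. of_real R * \<zeta>)) holomorphic_on ball 0 1"
      by (rule holomorphic_on_compose_gen[OF _ holg]) (use inb in \<open>auto intro!: holomorphic_intros\<close>)
    then show ?thesis by (simp add: o_def)
  qed
  have "f holomorphic_on ball 0 1"
    unfolding f_def by (intro holomorphic_intros holc) (use nz inb in auto)
  moreover have "f 0 = 0" by (simp add: f_def g0)
  moreover have "norm (f \<zeta>) < 1" if "norm \<zeta> < 1" for \<zeta>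
  proof -
    have "norm (of_real (2 * A) - g (of_real R * \<zeta>)) > 0" using nz[OF inb[OF that]] by simp
    then show ?thesis using lt[OF inb[OF that]] by (simp add: f_def norm_divide)
  qed
  moreover have "norm (z / of_real R) < 1" using z R by (simp add: norm_divide)
  ultimately have "norm (f (z / of_real R)) \<le> norm (z / of_real R)"
    by (rule Schwarz_Lemma(1))
  then have "norm (g z) / norm (of_real (2 * A) - g z) \<le> norm z / R"
    using R by (simp add: f_def norm_divide)
  moreover have "norm (of_real (2 * A) - g z) > 0" using nz[OF z] by simp
  ultimately have "norm (g z) * R \<le> norm z * norm (of_real (2 * A) - g z)"
    using R by (simp add: field_simps)
  also have "norm (of_real (2 * A) - g z) \<le> 2 * A + norm (g z)"
    using norm_triangle_ineq4[of "of_real (2 * A)" "g z"] A by simp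
  finally have "norm (g z) * R \<le> norm z * (2 * A + norm (g z))"
    by (simp add: mult_left_mono)
  then have "norm (g z) * (R - norm z) \<le> 2 * A * norm z" by (simp add: algebra_simps)
  then show ?thesis using z by (simp add: field_simps)
qed

text \<open>On the disc H = exp g, so the growth bound is an upper bound on the real part of g -
  g(0). Borel-Caratheodory turns it into |g - g(0)| <= 2A for |w| <= R/2, and Cauchy's estimate on
  the circle of radius R/4 about \<open>z\<close> bounds \<open>deriv g z\<close>, the logarithmic
  derivative of \<open>H\<close>.\<close>

lemma zero_free_log_deriv_bound:
  fixes H :: "complex \<Rightarrow> complex"
  assumes holH: "H holomorphic_on ball 0 R" and nz: "\<And>z. norm z < R \<Longrightarrow> H z \<noteq> 0"
    and bd: "\<And>z. norm z < R \<Longrightarrow> norm (H z) < exp A * norm (H 0)"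
    and R: "R > 0" and z: "norm z < R / 4"
  shows "norm (deriv H z / H z) \<le> 8 * A / R"
proof -
  obtain g where holg: "g holomorphic_on ball 0 R" and g: "\<And>x. x \<in> ball 0 R \<Longrightarrow> exp (g x) = H x"
    using holomorphic_logarithm_exists[of "ball 0 R" H 0] holH nz R by auto
  have re: "Re (g w - g 0) < A" if "norm w < R" for w
  proof -
    have "exp (Re (g w - g 0)) = norm (H w) / norm (H 0)"
      using g[of w] g[of 0] that R by (simp add: exp_diff flip: norm_exp_eq_Re norm_divide)
    also have "\<dots> < exp A" using bd[OF that] nz[of 0] R by (simp add: field_simps)
    finally show ?thesis by simp
  qed
  have A: "A > 0" using re[of 0] R by simp
  have "norm (g w - g 0) \<le> 2 * A" if "norm w \<le> R / 2" for w
  proof -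
    have "norm (g w - g 0) \<le> 2 * A * norm w / (R - norm w)"
      by (rule Borel_Caratheodory_ball[where R = R])
        (use holg re that R in \<open>auto intro!: holomorphic_intros\<close>)
    also have "\<dots> \<le> 2 * A"
      using that R A by (simp add: divide_simps) 
    finally show ?thesis .
  qed note half = this
  have sub: "norm w \<le> R / 2" if "norm (w - z) \<le> R / 4" for w
    using norm_triangle_ineq[of "w - z" z] that z by simp
  have sub': "cball z (R / 4) \<subseteq> ball 0 R"
    using sub R by (force simp: dist_norm norm_minus_commute)
  have hol': "(\<lambda>w. g w - g 0) holomorphic_on cball z (R / 4)"
    by (intro holomorphic_intros holomorphic_on_subset[OF holg] sub')
  have "norm ((deriv ^^ 1) (\<lambda>w. g w - g 0) z) \<le> fact 1 * (2 * A) / (R / 4) ^ 1"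
  proof (rule Cauchy_inequality)
    show "(\<lambda>w. g w - g 0) holomorphic_on ball z (R / 4)"
      using hol' by (rule holomorphic_on_subset) auto
    show "continuous_on (cball z (R / 4)) (\<lambda>w. g w - g 0)"
      using hol' by (rule holomorphic_on_imp_continuous_on)
    show "norm (g x - g 0) \<le> 2 * A" if "norm (z - x) = R / 4" for x
      using half[of x] sub[of x] that by (simp add: norm_minus_commute[of z x])
  qed (use R in auto)
  moreover have zR: "z \<in> ball 0 R" using z R norm_ge_zero[of z] by (simp del: norm_ge_zero)
  have dg: "(g has_field_derivative deriv g z) (at z)"
    using holomorphic_derivI[OF holg _ zR] by simp
  have "((\<lambda>w. g w - g 0) has_field_derivative deriv g z) (at z)"
    by (auto intro!: derivative_eq_intros dg)
  then have "deriv (\<lambda>w. g w - g 0) z = deriv g z" by (rule DERIV_imp_deriv)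
  moreover have "deriv H z = deriv g z * H z"
  proof (rule DERIV_imp_deriv)
    have "((\<lambda>w. exp (g w)) has_field_derivative exp (g z) * deriv g z) (at z)"
      by (auto intro!: derivative_eq_intros dg)
    then have "(H has_field_derivative exp (g z) * deriv g z) (at z)"
      by (rule has_field_derivative_transform_within_open[where S = "ball 0 R"]) (use g zR in auto)
    then show "(H has_field_derivative deriv g z * H z) (at z)"
      using g[OF zR] by (simp add: mult.commute)
  qed
  ultimately show ?thesis using nz[of z] zR by simp
qed

text \<open>Zeros are removed one at a time: the quotient by z - a has a removable singularity,
  filled by \<open>deriv H a\<close>. Simplicity enters there, since \<open>deriv F a\<close> is
  \<open>deriv H a\<close> times the product over the other zeros, so the filled value is
  nonzero.\<close>

lemma divide_out_simple_zeros:
  fixes F :: "complex \<Rightarrow> complex"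
  assumes holF: "F holomorphic_on UNIV" and "finite S"
    and "\<And>w. w \<in> S \<Longrightarrow> F w = 0 \<and> deriv F w \<noteq> 0"
  obtains H where "H holomorphic_on UNIV" "\<And>z. F z = (\<Prod>w\<in>S. z - w) * H z"
    "\<And>w. w \<in> S \<Longrightarrow> H w \<noteq> 0"
proof -
  have "\<exists>H. H holomorphic_on UNIV \<and> (\<forall>z. F z = (\<Prod>w\<in>S. z - w) * H z) \<and> (\<forall>w\<in>S. H w \<noteq> 0)"
    using assms(2,3)
  proof (induction S rule: finite_induct)
    case empty
    then show ?case using holF by auto
  next
    case (insert a S)
    then obtain H where H: "H holomorphic_on UNIV" "\<And>z. F z = (\<Prod>w\<in>S. z - w) * H z"
      "\<And>w. w \<in> S \<Longrightarrow> H w \<noteq> 0" by auto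
    have Pa: "(\<Prod>w\<in>S. a - w) \<noteq> 0" using insert by (auto simp: prod_zero_iff)
    have Ha: "H a = 0" using insert.prems[of a] H(2)[of a] Pa by auto
    define K where "K = (\<lambda>z. if z = a then deriv H a else H z / (z - a))"
    have eq: "H z = (z - a) * K z" for z using Ha by (simp add: K_def)
    have "K holomorphic_on UNIV"
      by (rule pole_theorem_open_0[OF H(1)]) (use eq Ha in \<open>auto simp: K_def\<close>)
    moreover have F: "F z = (\<Prod>w\<in>insert a S. z - w) * K z" for z
      using insert.hyps by (simp add: H(2)[of z] eq[of z] mult_ac)
    moreover have "K w \<noteq> 0" if "w \<in> insert a S" for w
    proof (cases "w = a")
      case True
      obtain P' where P': "((\<lambda>z. \<Prod>w\<in>S. z - w) has_field_derivative P') (at a)"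
        using has_field_derivative_prod[of S "\<lambda>w z. z - w" "\<lambda>_. 1" a]
        by (force intro!: derivative_eq_intros)
      have "(H has_field_derivative deriv H a) (at a)"
        using holomorphic_derivI[OF H(1)] by simp
      then have "((\<lambda>z. (\<Prod>w\<in>S. z - w) * H z) has_field_derivative deriv H a * (\<Prod>w\<in>S. a - w)) (at a)"
        by (auto intro!: derivative_eq_intros P' simp: Ha)
      moreover have "(\<lambda>z. (\<Prod>w\<in>S. z - w) * H z) = F" using H(2) by auto
      ultimately have "deriv F a = deriv H a * (\<Prod>w\<in>S. a - w)" using DERIV_imp_deriv by metis
      then show ?thesis using True insert.prems[of a] by (auto simp: K_def)
    next
      case False
      then show ?thesis using that H(3) by (simp add: K_def)
    qed
    ultimately show ?case by (intro exI[of _ K]) auto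
  qed
  then show ?thesis using that by blast
qed

text \<open>
  Dividing \<open>F\<close> by the product over the zeros in the disc of radius \<open>R\<close> does not increase it on the
  circle of radius \<open>2 R\<close>, so the quotient is zero-free in the disc with logarithm of real part
  \<open>o(R)\<close>, and its logarithmic derivative tends to \<open>0\<close>.
\<close>
lemma log_deriv_eq_lim_sum_zeros:
  fixes F :: "complex \<Rightarrow> complex"
  assumes holF: "F holomorphic_on UNIV" and F0: "F 0 = 1"
    and simple: "\<And>w. F w = 0 \<Longrightarrow> deriv F w \<noteq> 0"
    and growth: "\<And>\<epsilon>. \<epsilon> > 0 \<Longrightarrow> \<exists>C. \<forall>w. norm (F w) \<le> C * exp (\<epsilon> * norm w)"
    and z: "F z \<noteq> 0"
  shows "((\<lambda>R. \<Sum>w | F w = 0 \<and> norm w \<le> R. 1 / (z - w)) \<longlongrightarrow> deriv F z / F z) at_top"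
proof (rule tendstoI)
  fix e :: real assume e: "e > 0"
  \<comment> \<open>The final bound is 8 (ln C + 1) / R + 16 \<epsilon>. This choice makes the
    second part e/2, and the second lower bound on \<open>R\<close> keeps the first part below
    e/2.\<close>
  define \<epsilon> where "\<epsilon> = e / 32"
  have \<epsilon>: "\<epsilon> > 0" using e by (simp add: \<epsilon>_def)
  obtain C0 where C0: "\<And>w. norm (F w) \<le> C0 * exp (\<epsilon> * norm w)" using growth[OF \<epsilon>] by blast
  define C where "C = max C0 1"
  have C1: "C \<ge> 1" by (simp add: C_def)
  have C: "norm (F w) \<le> C * exp (\<epsilon> * norm w)" for w
    using C0[of w] by (smt (verit) C_def exp_gt_zero mult_right_mono max.cobounded1)
  have nonconst: "\<not> F constant_on UNIV" if "F w = 0" for w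
    using that F0 by (metis UNIV_I constant_on_def zero_neq_one)
  have fin: "finite {w. F w = 0 \<and> norm w \<le> R}" for R
  proof (cases "\<exists>w. F w = 0")
    case True
    have "finite {w \<in> cball 0 R. F w = 0}"
      by (rule holomorphic_compact_finite_zeros[OF holF]) (use True nonconst in auto)
    then show ?thesis by (rule rev_finite_subset) auto
  qed auto
  have "dist (\<Sum>w | F w = 0 \<and> norm w \<le> R. 1 / (z - w)) (deriv F z / F z) < e"
    if R: "R > 4 * norm z + 1" "R > 16 * (ln C + 1) / e" for R
  proof -
    have R0: "R > 0" using R norm_ge_zero[of z] by linarith
    define S where "S = {w. F w = 0 \<and> norm w \<le> R}"
    define Q where "Q = (\<lambda>z. \<Prod>w\<in>S. z - w)"
    obtain H where holH: "H holomorphic_on UNIV" and H: "\<And>z. F z = Q z * H z"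
      and HS: "\<And>w. w \<in> S \<Longrightarrow> H w \<noteq> 0"
      using divide_out_simple_zeros[OF holF, of S] simple fin[of R] unfolding S_def Q_def by blast
    have finS: "finite S" using fin by (simp add: S_def)
    have Hnz: "H w \<noteq> 0" if "norm w < R" for w
      using HS[of w] H[of w] that by (cases "F w = 0") (auto simp: S_def)
    have QH0: "Q 0 * H 0 = 1" using H[of 0] F0 by simp
    have Q0: "Q 0 \<noteq> 0" using QH0 by auto
    \<comment> \<open>The summand 1 makes the bound by \<open>exp A\<close> strict.\<close>
    define A where "A = ln C + 1 + \<epsilon> * (2 * R)"
    have sphere: "norm (H w) \<le> C * exp (\<epsilon> * (2 * R)) * norm (H 0)" if w: "norm w = 2 * R" for w
    proof -
      \<comment> \<open>Factor by factor: |v| <= R <= |w - v| whenever |v| <= R and |w| =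
        2R.\<close>
      have "norm (Q 0) \<le> norm (Q w)"
        unfolding Q_def prod_norm[symmetric]
      proof (rule prod_mono)
        fix v assume "v \<in> S"
        then have "norm v \<le> R" by (simp add: S_def)
        then show "0 \<le> norm (0 - v) \<and> norm (0 - v) \<le> norm (w - v)"
          using norm_triangle_ineq2[of w v] w by simp
      qed
      then have "norm (H w) * norm (Q 0) \<le> norm (H w) * norm (Q w)" by (simp add: mult_left_mono)
      also have "\<dots> = norm (F w)" by (simp add: H norm_mult)
      also have "\<dots> \<le> C * exp (\<epsilon> * (2 * R))" using C[of w] w by simp
      finally have "norm (H w) * norm (Q 0) * norm (H 0) \<le> C * exp (\<epsilon> * (2 * R)) * norm (H 0)"
        by (simp add: mult_right_mono)
      moreover have "norm (Q 0) * norm (H 0) = 1" using QH0 by (metis norm_mult norm_one)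
      ultimately show ?thesis by (simp add: mult.assoc)
    qed
    have H0: "norm (H 0) > 0" using QH0 by auto
    have bd: "norm (H w) < exp A * norm (H 0)" if "norm w < R" for w
    proof -
      have "norm (H w) \<le> C * exp (\<epsilon> * (2 * R)) * norm (H 0)"
      proof (rule maximum_modulus_frontier[where S = "ball 0 (2 * R)" and f = H])
        show "H holomorphic_on interior (ball 0 (2 * R))" using holH holomorphic_on_subset by blast
        show "continuous_on (closure (ball 0 (2 * R))) H"
          using holH holomorphic_on_imp_continuous_on holomorphic_on_subset by blast
        show "norm (H w) \<le> C * exp (\<epsilon> * (2 * R)) * norm (H 0)" if "w \<in> frontier (ball 0 (2 * R))" for w
          using sphere[of w] that R0 by (simp add: frontier_ball)
      qed (use that R0 in auto)
      also have "C * exp (\<epsilon> * (2 * R)) < exp A"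
        using C1 by (simp add: A_def exp_add)
      finally show ?thesis using H0 by simp
    qed
    have "norm (deriv H z / H z) \<le> 8 * A / R"
      by (rule zero_free_log_deriv_bound) (use holH Hnz bd R0 R holomorphic_on_subset in auto)
    also have "8 * A / R = 8 * (ln C + 1) / R + 16 * \<epsilon>" using R0 by (simp add: A_def field_simps)
    also have "\<dots> < e"
      using R(2) R0 e by (simp add: \<epsilon>_def field_simps)
    finally have small: "norm (deriv H z / H z) < e" .
    have Qz: "Q z \<noteq> 0" and Hz: "H z \<noteq> 0" using H[of z] z by auto
    have ne: "z - w \<noteq> 0" if "w \<in> S" for w using that z by (auto simp: S_def)
    have dQ: "(Q has_field_derivative Q z * (\<Sum>w\<in>S. 1 / (z - w))) (at z)"
      unfolding Q_def by (rule has_field_derivative_prod') (use ne in \<open>auto intro!: derivative_eq_intros\<close>)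
    have dH: "(H has_field_derivative deriv H z) (at z)" using holomorphic_derivI[OF holH] by simp
    have "((\<lambda>z. Q z * H z) has_field_derivative Q z * (\<Sum>w\<in>S. 1 / (z - w)) * H z + deriv H z * Q z) (at z)"
      by (auto intro!: derivative_eq_intros dQ dH)
    moreover have "(\<lambda>z. Q z * H z) = F" using H by auto
    ultimately have "deriv F z = Q z * (\<Sum>w\<in>S. 1 / (z - w)) * H z + deriv H z * Q z"
      using DERIV_imp_deriv by metis
    then have "deriv F z / F z = (\<Sum>w\<in>S. 1 / (z - w)) + deriv H z / H z"
      using Qz Hz by (simp add: H[of z] field_simps)
    then show ?thesis using small by (simp add: S_def dist_norm norm_minus_commute)
  qed
  then show "\<forall>\<^sub>F R in at_top. dist (\<Sum>w | F w = 0 \<and> norm w \<le> R. 1 / (z - w)) (deriv F z / F z) < e"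
    unfolding eventually_at_top_dense
    by (intro exI[of _ "max (4 * norm z + 1) (16 * (ln C + 1) / e)"]) auto
qed

section \<open>Everywhere convergent power series with real coefficients\<close>

text \<open>The type of the argument is left open so that one real coefficient sequence yields both
  a function on the reals and its entire extension to the complex plane.\<close>

definition power_series :: "(nat \<Rightarrow> real) \<Rightarrow> 'a::{real_normed_field,banach} \<Rightarrow> 'a" where
  "power_series c w = (\<Sum>n. of_real (c n) * w ^ n)"

definition entire_coeffs :: "(nat \<Rightarrow> real) \<Rightarrow> bool" where
  "entire_coeffs c \<longleftrightarrow> (\<forall>r. summable (\<lambda>n. \<bar>c n\<bar> * r ^ n))"

lemma entire_coeffs_summable_norm:
  fixes w :: "'a::{real_normed_field,banach}"
  assumes "entire_coeffs c"
  shows "summable (\<lambda>n. norm (of_real (c n) * w ^ n))"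
  using assms unfolding entire_coeffs_def by (simp add: norm_mult norm_power)

lemma entire_coeffs_summable:
  fixes w :: "'a::{real_normed_field,banach}"
  assumes "entire_coeffs c"
  shows "summable (\<lambda>n. of_real (c n) * w ^ n)"
  using entire_coeffs_summable_norm[OF assms] by (rule summable_norm_cancel)

lemma entire_coeffs_diffs:
  assumes "entire_coeffs c"
  shows "entire_coeffs (diffs c)"
proof -
  have "(\<lambda>n. \<bar>diffs c n\<bar>) = diffs (\<lambda>n. \<bar>c n\<bar>)" by (auto simp: diffs_def abs_mult)
  moreover have "summable (\<lambda>n. diffs (\<lambda>n. \<bar>c n\<bar>) n * r ^ n)" for r
    by (rule termdiff_converges_all) (use assms in \<open>auto simp: entire_coeffs_def\<close>)
  ultimately show ?thesis unfolding entire_coeffs_def by metis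
qed

lemma power_series_of_real:
  assumes "entire_coeffs c"
  shows "power_series c (of_real x :: 'a::{real_normed_field,banach}) = of_real (power_series c x)"
  unfolding power_series_def using suminf_of_real[OF entire_coeffs_summable[OF assms, of x], where 'a = 'a]
  by simp

lemma power_series_0: "power_series c 0 = of_real (c 0)"
  using powser_zero[of "\<lambda>n. of_real (c n) :: 'a"] by (simp add: power_series_def)

lemma power_series_add:
  assumes "entire_coeffs c" "entire_coeffs d"
  shows "power_series c w + power_series d w = power_series (\<lambda>n. c n + d n) w"
  unfolding power_series_def
  using suminf_add[OF entire_coeffs_summable[OF assms(1)] entire_coeffs_summable[OF assms(2)]]
  by (simp add: algebra_simps)

lemma power_series_cmult:
  assumes "entire_coeffs c"
  shows "of_real a * power_series c w = power_series (\<lambda>n. a * c n) w"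
  unfolding power_series_def
  using suminf_mult[OF entire_coeffs_summable[OF assms], of "of_real a" w] by (simp add: mult.assoc)

lemma entire_coeffs_add: "entire_coeffs c \<Longrightarrow> entire_coeffs d \<Longrightarrow> entire_coeffs (\<lambda>n. c n + d n)"
  unfolding entire_coeffs_def
proof
  fix r :: real
  assume "\<forall>r. summable (\<lambda>n. \<bar>c n\<bar> * r ^ n)" "\<forall>r. summable (\<lambda>n. \<bar>d n\<bar> * r ^ n)"
  then have "summable (\<lambda>n. \<bar>c n\<bar> * \<bar>r\<bar> ^ n + \<bar>d n\<bar> * \<bar>r\<bar> ^ n)" by (intro summable_add) auto
  then show "summable (\<lambda>n. \<bar>c n + d n\<bar> * r ^ n)"
    by (rule summable_comparison_test[rotated])
      (auto simp: abs_mult power_abs intro!: exI[of _ 0]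
        simp flip: distrib_right intro!: mult_right_mono)
qed

lemma entire_coeffs_cmult: "entire_coeffs c \<Longrightarrow> entire_coeffs (\<lambda>n. a * c n)"
  unfolding entire_coeffs_def by (auto simp: abs_mult mult.assoc intro!: summable_mult)

lemma power_series_has_field_derivative:
  fixes w :: "'a::{real_normed_field,banach}"
  assumes "entire_coeffs c"
  shows "(power_series c has_field_derivative power_series (diffs c) w) (at w)"
proof -
  have "((\<lambda>w. \<Sum>n. of_real (c n) * w ^ n) has_field_derivative
      (\<Sum>n. diffs (\<lambda>n. of_real (c n) :: 'a) n * w ^ n)) (at w)"
    by (rule termdiffs_strong_converges_everywhere) (rule entire_coeffs_summable[OF assms])
  moreover have "diffs (\<lambda>n. of_real (c n) :: 'a) = (\<lambda>n. of_real (diffs c n))"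
    by (auto simp: diffs_def)
  ultimately show ?thesis by (simp add: power_series_def [abs_def])
qed

lemma power_series_mult_diffs_sums:
  fixes w :: "'a::{real_normed_field,banach}"
  assumes "entire_coeffs c"
  shows "(\<lambda>n. of_nat n * of_real (c n) * w ^ n) sums (w * power_series (diffs c) w)"
proof -
  have eq: "diffs (\<lambda>n. of_real (c n) :: 'a) = (\<lambda>n. of_real (diffs c n))"
    by (auto simp: diffs_def)
  have "summable (\<lambda>n. diffs (\<lambda>n. of_real (c n) :: 'a) n * w ^ n)"
    unfolding eq by (intro entire_coeffs_summable entire_coeffs_diffs assms)
  from diffs_equiv[OF this]
  have "(\<lambda>n. w * (of_nat n * of_real (c n) * w ^ (n - Suc 0))) sums (w * power_series (diffs c) w)"
    unfolding eq power_series_def by (rule sums_mult)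
  moreover have "w * (of_nat n * of_real (c n) * w ^ (n - Suc 0)) = of_nat n * of_real (c n) * w ^ n" for n
    by (cases n) auto
  ultimately show ?thesis by simp
qed

text \<open>The Euler operator w d/dw multiplies the nth coefficient by n. Differential identities
  thereby become identities between coefficients.\<close>

lemma power_series_mult_diffs:
  fixes w :: "'a::{real_normed_field,banach}"
  assumes "entire_coeffs c"
  shows "w * power_series (diffs c) w = power_series (\<lambda>n. of_nat n * c n) w"
    and "entire_coeffs (\<lambda>n. of_nat n * c n)"
proof -
  show "w * power_series (diffs c) w = power_series (\<lambda>n. of_nat n * c n) w"
    using sums_unique[OF power_series_mult_diffs_sums[OF assms, of w]] by (simp add: power_series_def)
  have "entire_coeffs (\<lambda>n. \<bar>c n\<bar>)" using assms by (simp add: entire_coeffs_def)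
  from sums_summable[OF power_series_mult_diffs_sums[OF this, where 'a = real]]
  show "entire_coeffs (\<lambda>n. of_nat n * c n)"
    by (auto simp: entire_coeffs_def abs_mult)
qed

text \<open>Termwise comparison with the exponential series. Having such coefficient bounds for
  every \<epsilon> > 0 gives exponential type zero.\<close>

lemma power_series_norm_le:
  fixes w :: "'a::{real_normed_field,banach}"
  assumes "entire_coeffs c" "\<And>n. \<bar>c n\<bar> \<le> C * \<epsilon> ^ n / fact n"
  shows "norm (power_series c w) \<le> C * exp (\<epsilon> * norm w)"
proof -
  have s: "(\<lambda>n. C * ((\<epsilon> * norm w) ^ n /\<^sub>R fact n)) sums (C * exp (\<epsilon> * norm w))"
    by (intro sums_mult exp_converges)
  have "norm (power_series c w) \<le> (\<Sum>n. norm (of_real (c n) * w ^ n))"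
    unfolding power_series_def by (rule summable_norm[OF entire_coeffs_summable_norm[OF assms(1)]])
  also have "\<dots> \<le> (\<Sum>n. C * ((\<epsilon> * norm w) ^ n /\<^sub>R fact n))"
  proof (rule suminf_le[OF _ entire_coeffs_summable_norm[OF assms(1)] sums_summable[OF s]])
    fix n
    have "\<bar>c n\<bar> * norm w ^ n \<le> C * \<epsilon> ^ n / fact n * norm w ^ n"
      by (rule mult_right_mono[OF assms(2)]) simp
    then show "norm (of_real (c n) * w ^ n) \<le> C * ((\<epsilon> * norm w) ^ n /\<^sub>R fact n)"
      by (simp add: norm_mult norm_power power_mult_distrib field_simps)
  qed
  also have "\<dots> = C * exp (\<epsilon> * norm w)" using sums_unique[OF s] by simp
  finally show ?thesis .
qed

lemma entire_coeffs_if_le: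
  assumes "\<And>n. \<bar>c n\<bar> \<le> C * \<epsilon> ^ n / fact n"
  shows "entire_coeffs c"
  unfolding entire_coeffs_def
proof
  fix r :: real
  have s: "summable (\<lambda>n. C * ((\<epsilon> * \<bar>r\<bar>) ^ n /\<^sub>R fact n))"
    by (intro summable_mult sums_summable[OF exp_converges])
  show "summable (\<lambda>n. \<bar>c n\<bar> * r ^ n)"
  proof (rule summable_comparison_test'[OF s, of 0])
    fix n
    have "\<bar>c n\<bar> * \<bar>r\<bar> ^ n \<le> C * \<epsilon> ^ n / fact n * \<bar>r\<bar> ^ n"
      by (rule mult_right_mono[OF assms]) simp
    then show "norm (\<bar>c n\<bar> * r ^ n) \<le> C * ((\<epsilon> * \<bar>r\<bar>) ^ n /\<^sub>R fact n)"
      by (simp add: abs_mult power_abs power_mult_distrib field_simps)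
  qed
qed

section \<open>Sums over discrete sets of positive reals\<close>

lemma has_sum_diff_real:
  fixes f g :: "'a \<Rightarrow> real"
  assumes "(f has_sum a) A" "(g has_sum b) A"
  shows "((\<lambda>x. f x - g x) has_sum (a - b)) A"
  using has_sum_add[OF assms(1), of "\<lambda>x. - g x" "- b"] assms(2) by (simp add: has_sum_uminus)

lemma has_sum_sum_real:
  fixes f :: "'i \<Rightarrow> 'a \<Rightarrow> real"
  assumes "\<And>i. i \<in> I \<Longrightarrow> (f i has_sum a i) A"
  shows "((\<lambda>x. \<Sum>i\<in>I. f i x) has_sum (\<Sum>i\<in>I. a i)) A"
  using assms by (induction I rule: infinite_finite_induct) (auto intro!: has_sum_add)

text \<open>For nonnegative terms the order of summation is immaterial: every finite partial sum is
  eventually contained in an exhausting sum, hence at most \<open>L\<close>. This gives summability,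
  and the exhausting sums then also tend to the unordered sum.\<close>

lemma has_sum_if_exhaustion_tendsto:
  fixes f :: "real \<Rightarrow> real"
  assumes nonneg: "\<And>x. x \<in> Z \<Longrightarrow> f x \<ge> 0" and fin: "\<And>R. finite {x \<in> Z. x \<le> R}"
    and lim: "((\<lambda>R. \<Sum>x | x \<in> Z \<and> x \<le> R. f x) \<longlongrightarrow> L) at_top"
  shows "(f has_sum L) Z"
proof -
  have ex: "filterlim (\<lambda>R. {x \<in> Z. x \<le> R}) (finite_subsets_at_top Z) at_top"
    unfolding filterlim_finite_subsets_at_top
  proof (intro allI impI)
    fix X assume X: "finite X \<and> X \<subseteq> Z"
    have "\<forall>\<^sub>F R in at_top. \<forall>x\<in>X. x \<le> R"
      using X by (intro eventually_ball_finite) (auto intro: eventually_ge_at_top)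
    then show "\<forall>\<^sub>F R in at_top. finite {x \<in> Z. x \<le> R} \<and> X \<subseteq> {x \<in> Z. x \<le> R} \<and> {x \<in> Z. x \<le> R} \<subseteq> Z"
      by eventually_elim (use X fin in auto)
  qed
  have bound: "sum f X \<le> L" if X: "finite X" "X \<subseteq> Z" for X
  proof (rule tendsto_lowerbound[OF lim])
    have "\<forall>\<^sub>F R in at_top. X \<subseteq> {x \<in> Z. x \<le> R}"
      using ex X unfolding filterlim_finite_subsets_at_top by (metis (mono_tags, lifting) eventually_mono)
    then show "\<forall>\<^sub>F R in at_top. sum f X \<le> (\<Sum>x | x \<in> Z \<and> x \<le> R. f x)"
      by eventually_elim (use fin nonneg in \<open>auto intro!: sum_mono2\<close>)
  qed simp
  have "f summable_on Z"
    by (rule nonneg_bdd_above_summable_on[OF nonneg]) (use bound in \<open>auto intro!: bdd_aboveI[of _ L]\<close>)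
  then have s: "(f has_sum infsum f Z) Z" by simp
  then have "((\<lambda>R. \<Sum>x | x \<in> Z \<and> x \<le> R. f x) \<longlongrightarrow> infsum f Z) at_top"
    unfolding has_sum_def using filterlim_compose ex by fastforce
  then have "infsum f Z = L" using lim tendsto_unique trivial_limit_at_top_linorder by blast
  then show ?thesis using s by simp
qed

text \<open>The rank \<open>c x\<close>, the number of elements up to \<open>x\<close>, is injective
  and takes every positive integer as a value, the next element being the minimum of those above the
  current one; \<open>e\<close> is its inverse. The form of \<open>e\<close> matches the definition
  of \<open>dini_zero\<close>.\<close>

lemma bij_betw_nth_element:
  fixes P :: "'a::linorder set"
  assumes inf: "infinite P" and fin: "\<And>x. finite {y \<in> P. y \<le> x}"
  defines "e \<equiv> (\<lambda>n. THE x. x \<in> P \<and> card {y \<in> P. y \<le> x} = n)"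
  shows "bij_betw e {1..} P" and "x \<in> P \<Longrightarrow> e 1 \<le> x"
proof -
  define c where "c = (\<lambda>x. card {y \<in> P. y \<le> x})"
  have c_less: "c x < c y" if "x \<in> P" "y \<in> P" "x < y" for x y
    unfolding c_def by (rule psubset_card_mono[OF fin], use that in \<open>auto simp: psubset_eq set_eq_iff intro!: exI[of _ y]\<close>)
  have inj: "x = y" if "x \<in> P" "y \<in> P" "c x = c y" for x y
    using c_less[of x y] c_less[of y x] that by (cases x y rule: linorder_cases) auto
  have pos: "c x \<ge> 1" if "x \<in> P" for x
    using fin[of x] that by (auto simp: c_def Suc_le_eq card_gt_0_iff)
  have surj: "\<exists>x\<in>P. c x = Suc k" for k
  proof (induction k)
    case 0
    obtain x0 where x0: "x0 \<in> P" using inf by (metis finite.emptyI ex_in_conv)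
    define M where "M = {y \<in> P. y \<le> x0}"
    have M: "finite M" "M \<noteq> {}" using fin x0 by (auto simp: M_def)
    have "Min M \<in> M" using M by simp
    moreover have "{y \<in> P. y \<le> Min M} = {Min M}"
    proof -
      have "y = Min M" if "y \<in> P" "y \<le> Min M" for y
        using that \<open>Min M \<in> M\<close> M by (intro antisym Min_le) (auto simp: M_def)
      then show ?thesis using \<open>Min M \<in> M\<close> by (auto simp: M_def)
    qed
    ultimately show ?case by (intro bexI[of _ "Min M"]) (auto simp: c_def M_def)
  next
    case (Suc k)
    then obtain x where x: "x \<in> P" "c x = Suc k" by blast
    obtain y where y: "y \<in> P" "x < y"
      using inf fin[of x] by (metis (mono_tags, lifting) finite_subset mem_Collect_eq not_le subsetI)
    define M where "M = {z \<in> P. x < z \<and> z \<le> y}"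
    have M: "finite M" "M \<noteq> {}" using fin[of y] y by (auto simp: M_def elim: rev_finite_subset)
    have mM: "Min M \<in> M" using M by simp
    have "{z \<in> P. z \<le> Min M} = insert (Min M) {z \<in> P. z \<le> x}"
    proof -
      have "z = Min M" if "z \<in> P" "z \<le> Min M" "\<not> z \<le> x" for z
        using that mM M by (intro antisym Min_le) (auto simp: M_def)
      then show ?thesis using mM by (auto simp: M_def)
    qed
    moreover have "Min M \<notin> {z \<in> P. z \<le> x}" using mM by (simp add: M_def not_le)
    ultimately have "c (Min M) = Suc (c x)" using fin[of x] by (simp add: c_def)
    then show ?case using x mM by (auto simp: M_def)
  qed
  have e: "e n \<in> P \<and> c (e n) = n" if "n \<ge> 1" for n
  proof -
    have "Suc (n - 1) = n" using that by simp
    then obtain x where "x \<in> P" "c x = n" using surj[of "n - 1"] by metis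
    then show ?thesis
      unfolding e_def c_def by - (rule theI[of _ x]; use inj in \<open>auto simp: c_def\<close>)
  qed
  have ec: "e (c x) = x" if "x \<in> P" for x using e[OF pos[OF that]] inj that by auto
  show "bij_betw e {1..} P" by (rule bij_betw_byWitness[of _ c]) (use e ec pos in auto)
  show "e 1 \<le> x" if "x \<in> P" using e[of 1] pos[OF that] c_less[of x "e 1"] that by fastforce
qed

section \<open>Expansion of a partial fraction sum relative to its smallest pole\<close>

locale positive_spectrum =
  fixes Z :: "real set" and w1 w2 :: real and G :: "real \<Rightarrow> real"
  assumes w1: "0 < w1" "w1 \<in> Z" and w2: "w1 < w2" "w2 \<in> Z"
    and w1_le: "\<And>x. x \<in> Z \<Longrightarrow> w1 \<le> x" and w2_le: "\<And>x. x \<in> Z \<Longrightarrow> x \<noteq> w1 \<Longrightarrow> w2 \<le> x"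
    and G: "\<And>t. 0 \<le> t \<Longrightarrow> t < w1 \<Longrightarrow> ((\<lambda>x. 1 / (x - t)) has_sum G t) Z"
begin

definition \<eta> :: "nat \<Rightarrow> real" where "\<eta> m = (\<Sum>\<^sub>\<infinity>x\<in>Z. 1 / x ^ m)"

text \<open>The remainder function in the expansion of (w1 - t) G(t). For \<open>t = w1\<close> the
  summand at \<open>x = w1\<close> is 0/0, which evaluates to 0; this agrees with its value for
  every smaller \<open>t\<close>, so the endpoint needs no separate definition.\<close>

definition S :: "nat \<Rightarrow> real \<Rightarrow> real" where
  "S N t = (\<Sum>\<^sub>\<infinity>x\<in>Z. (x - w1) / (x ^ (N + 1) * (x - t)))"

lemma Z_pos: "x \<in> Z \<Longrightarrow> x > 0"
  using w1 w1_le by fastforce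

text \<open>The sum for \<open>G\<close> at 0 is the case \<open>m = 1\<close>; it dominates the
  higher powers because \<open>w1\<close> is a positive lower bound of \<open>Z\<close>.\<close>

lemma \<eta>_has_sum:
  assumes "m \<ge> 1"
  shows "((\<lambda>x. 1 / x ^ m) has_sum \<eta> m) Z"
proof -
  have "(\<lambda>x. 1 / w1 ^ (m - 1) * (1 / (x - 0))) summable_on Z"
    using G[of 0] w1 by (intro summable_on_cmult_right) (auto simp: summable_on_def)
  then have "(\<lambda>x. 1 / x ^ m) summable_on Z"
  proof (rule summable_on_comparison_test)
    fix x assume x: "x \<in> Z"
    have "w1 ^ (m - 1) \<le> x ^ (m - 1)" using w1 w1_le[OF x] by (intro power_mono) auto
    then have "1 / x ^ (m - 1) * (1 / x) \<le> 1 / w1 ^ (m - 1) * (1 / x)"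
      using w1 Z_pos[OF x] by (intro mult_right_mono divide_left_mono) auto
    moreover have "x ^ m = x ^ (m - 1) * x" using assms by (simp flip: power_Suc2)
    ultimately show "1 / x ^ m \<le> 1 / w1 ^ (m - 1) * (1 / (x - 0))" by simp
  qed (use Z_pos in \<open>auto intro: less_imp_le\<close>)
  then show ?thesis by (simp add: \<eta>_def)
qed

lemma \<eta>_1: "\<eta> 1 = G 0"
  using has_sum_unique[OF \<eta>_has_sum[of 1], of "G 0"] G[of 0] w1 by simp

lemma \<eta>_nonneg: "\<eta> m \<ge> 0"
  unfolding \<eta>_def by (rule infsum_nonneg) (use Z_pos in \<open>auto intro!: less_imp_le\<close>)

text \<open>Since t <= w1 <= x, the factor (x - w1) / (x - t) is at most 1, so the terms are
  dominated by those of \<open>\<eta> (N + 1)\<close>.\<close>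

lemma S_has_sum:
  assumes "t \<le> w1"
  shows "((\<lambda>x. (x - w1) / (x ^ (N + 1) * (x - t))) has_sum S N t) Z"
proof -
  have "(\<lambda>x. 1 / x ^ (N + 1)) summable_on Z" using \<eta>_has_sum[of "N + 1"] by (auto simp: summable_on_def)
  then have "(\<lambda>x. (x - w1) / (x ^ (N + 1) * (x - t))) summable_on Z"
  proof (rule summable_on_comparison_test)
    fix x assume x: "x \<in> Z"
    show "0 \<le> (x - w1) / (x ^ (N + 1) * (x - t))"
      using assms w1_le[OF x] Z_pos[OF x] by (intro divide_nonneg_nonneg mult_nonneg_nonneg) auto
    have "(x - w1) / (x - t) \<le> 1" using assms w1_le[OF x] by (simp add: divide_le_eq)
    then have "1 / x ^ (N + 1) * ((x - w1) / (x - t)) \<le> 1 / x ^ (N + 1) * 1"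
      using Z_pos[OF x] by (intro mult_left_mono) auto
    then show "(x - w1) / (x ^ (N + 1) * (x - t)) \<le> 1 / x ^ (N + 1)" by simp
  qed
  then show ?thesis by (simp add: S_def)
qed

text \<open>At \<open>t = w1\<close> the quotient \<open>(w1 - t) / (x - t)\<close> for \<open>x = w1\<close> takes its limit value \<open>1\<close>.\<close>
lemma S_expansion:
  assumes "0 \<le> t" "t \<le> w1"
  shows "((\<lambda>x. if x = w1 then 1 else (w1 - t) / (x - t)) has_sum
    (w1 * \<eta> 1 + (\<Sum>m=1..N. (w1 * \<eta> (m + 1) - \<eta> m) * t ^ m) - t ^ (N + 1) * S N t)) Z"
proof -
  have fin_sum: "(if x = w1 then 1 else (w1 - t) / (x - t)) =
      w1 * (1 / x ^ 1) + (\<Sum>m=1..N. (w1 * (1 / x ^ (m + 1)) - 1 / x ^ m) * t ^ m)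
      - t ^ (N + 1) * ((x - w1) / (x ^ (N + 1) * (x - t)))" (is "?L = ?R N") if x: "x \<in> Z" for x
  proof (cases "x = w1")
    case True
    then show ?thesis using w1 by simp
  next
    case False
    have ne: "x - t \<noteq> 0" "x \<noteq> 0" using False w1_le[OF x] assms Z_pos[OF x] by auto
    have "?L = ?R N"
    proof (induction N)
      case 0
      then show ?case using False ne by (simp add: field_simps)
    next
      case (Suc N)
      \<comment> \<open>Since 1 + t/(x - t) = x/(x - t), the new summand and the new remainder
        combine to the old remainder.\<close>
      have "(w1 * (1 / x ^ (Suc N + 1)) - 1 / x ^ Suc N) * t ^ Suc N
          - t ^ (Suc N + 1) * ((x - w1) / (x ^ (Suc N + 1) * (x - t)))
          = - (t ^ (N + 1) * ((x - w1) / (x ^ (N + 1) * (x - t))))"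
        using ne by (simp add: divide_simps) (simp add: algebra_simps)
      then show ?case using Suc by simp
    qed
    then show ?thesis .
  qed
  have "((\<lambda>x. w1 * (1 / x ^ 1) + (\<Sum>m=1..N. (w1 * (1 / x ^ (m + 1)) - 1 / x ^ m) * t ^ m)
      - t ^ (N + 1) * ((x - w1) / (x ^ (N + 1) * (x - t)))) has_sum
    (w1 * \<eta> 1 + (\<Sum>m=1..N. (w1 * \<eta> (m + 1) - \<eta> m) * t ^ m) - t ^ (N + 1) * S N t)) Z"
    by (intro has_sum_diff_real has_sum_add has_sum_sum_real has_sum_cmult_left has_sum_cmult_right \<eta>_has_sum
        S_has_sum assms) auto
  then show ?thesis by (subst has_sum_cong[OF fin_sum]) auto
qed

lemma G_expansion:
  assumes "0 \<le> t" "t < w1"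
  shows "(w1 - t) * G t = w1 * \<eta> 1 + (\<Sum>m=1..N. (w1 * \<eta> (m + 1) - \<eta> m) * t ^ m) - t ^ (N + 1) * S N t"
proof -
  have "((\<lambda>x. (w1 - t) * (1 / (x - t))) has_sum (w1 - t) * G t) Z"
    by (intro has_sum_cmult_right G assms)
  moreover have "(\<lambda>x. (w1 - t) * (1 / (x - t))) = (\<lambda>x. if x = w1 then 1 else (w1 - t) / (x - t))"
    using assms by auto
  ultimately show ?thesis using has_sum_unique[OF _ S_expansion[of t N]] assms by simp
qed

text \<open>At \<open>t = w1\<close> every summand of \<open>S_expansion\<close> except the one at
  \<open>w1\<close> vanishes, so the sum is 1. This is the source of the 1 in
  \<open>dini_a\<close>.\<close>

lemma S_at_w1:
  "w1 ^ (N + 1) * S N w1 = w1 * \<eta> 1 + (\<Sum>m=1..N. (w1 * \<eta> (m + 1) - \<eta> m) * w1 ^ m) - 1"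
proof -
  have "((\<lambda>x. if x = w1 then 1 else (w1 - w1) / (x - w1)) has_sum 1) Z"
    using has_sum_finite_neutralI[of "{w1}" Z "\<lambda>x. if x = w1 then 1 else (w1 - w1) / (x - w1)" 1] w1 by auto
  then show ?thesis using has_sum_unique[OF S_expansion[of w1 N]] w1 by fastforce
qed

lemma S_at_0: "S N 0 = - (w1 * \<eta> (N + 2) - \<eta> (N + 1))"
proof -
  have "((\<lambda>x. 1 / x ^ (N + 1) - w1 * (1 / x ^ (N + 2))) has_sum (\<eta> (N + 1) - w1 * \<eta> (N + 2))) Z"
    by (intro has_sum_diff_real has_sum_cmult_right \<eta>_has_sum) auto
  moreover have "(x - w1) / (x ^ (N + 1) * (x - 0)) = 1 / x ^ (N + 1) - w1 * (1 / x ^ (N + 2))"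
    if "x \<in> Z" for x using Z_pos[OF that] by (simp add: divide_simps)
  ultimately have "((\<lambda>x. (x - w1) / (x ^ (N + 1) * (x - 0))) has_sum (\<eta> (N + 1) - w1 * \<eta> (N + 2))) Z"
    by (simp cong: has_sum_cong)
  with has_sum_unique S_has_sum[of 0 N] w1 show ?thesis by fastforce
qed

text \<open>Each summand with x > w1 increases strictly in its parameter, while the one at
  \<open>w1\<close> is constantly 0. Strictness of the sum therefore needs a second element,
  \<open>w2\<close>.\<close>

lemma S_strict_mono:
  assumes "0 \<le> s" "s < t" "t \<le> w1"
  shows "S N s < S N t"
proof (rule has_sum_strict_mono[OF S_has_sum[of s N] S_has_sum[of t N] _ w2(2)])
  have less: "(x - w1) / (x ^ (N + 1) * (x - s)) < (x - w1) / (x ^ (N + 1) * (x - t))"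
    if "x \<in> Z" "x \<noteq> w1" for x
  proof -
    have p: "x > 0" "x - w1 > 0" using that w1_le[of x] Z_pos[of x] by auto
    show ?thesis
      using p assms by (intro divide_strict_left_mono mult_strict_left_mono mult_pos_pos) auto
  qed
  then show "(x - w1) / (x ^ (N + 1) * (x - s)) \<le> (x - w1) / (x ^ (N + 1) * (x - t))"
    if "x \<in> Z" for x using that less[of x] by (cases "x = w1") (auto intro: less_imp_le)
  show "(w2 - w1) / (w2 ^ (N + 1) * (w2 - s)) < (w2 - w1) / (w2 ^ (N + 1) * (w2 - t))"
    using less[of w2] w2 by simp
qed (use assms in auto)

text \<open>An explicit rate of approach to \<open>S N 0\<close>, for the sharpness of the upper
  constant. The summands at \<open>t\<close> and 0 differ by t / x^(N+2) times (x - w1) / (x - t), a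
  factor of at most 1.\<close>

lemma S_le_near_0:
  assumes "0 \<le> t" "t \<le> w1"
  shows "S N t \<le> S N 0 + t * \<eta> (N + 2)"
proof (rule has_sum_mono[OF S_has_sum[of t N]])
  show "((\<lambda>x. (x - w1) / (x ^ (N + 1) * (x - 0)) + t * (1 / x ^ (N + 2))) has_sum S N 0 + t * \<eta> (N + 2)) Z"
    using w1 by (intro has_sum_add has_sum_cmult_right S_has_sum \<eta>_has_sum) auto
  fix x assume x: "x \<in> Z"
  show "(x - w1) / (x ^ (N + 1) * (x - t)) \<le> (x - w1) / (x ^ (N + 1) * (x - 0)) + t * (1 / x ^ (N + 2))"
  proof (cases "x = w1")
    case False
    then have p: "x > 0" "x - t > 0" using x assms w1_le[OF x] Z_pos[OF x] by auto
    have "(x - w1) / (x ^ (N + 1) * (x - t)) - (x - w1) / (x ^ (N + 1) * (x - 0))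
        = t * (1 / x ^ (N + 2)) * ((x - w1) / (x - t))"
      using p by (simp add: divide_simps) (simp add: algebra_simps)
    also have "\<dots> \<le> t * (1 / x ^ (N + 2)) * 1"
      using p assms by (intro mult_left_mono) auto
    finally show ?thesis by simp
  qed (use assms w1 in simp)
qed (use assms in auto)

text \<open>The counterpart at the other endpoint, for the sharpness of the lower constant. The
  summand at \<open>w1\<close> is 0 throughout, and for all others x - t is bounded below by the gap
  w2 - w1, so the rate is uniform in x.\<close>

lemma S_ge_near_w1:
  assumes "0 \<le> t" "t \<le> w1"
  shows "S N t \<ge> S N w1 - (w1 - t) / (w2 - w1) * \<eta> (N + 1)"
proof (rule has_sum_mono[OF _ S_has_sum[of t N]])
  show "((\<lambda>x. (x - w1) / (x ^ (N + 1) * (x - w1)) - (w1 - t) / (w2 - w1) * (1 / x ^ (N + 1))) has_sum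
      S N w1 - (w1 - t) / (w2 - w1) * \<eta> (N + 1)) Z"
    by (intro has_sum_diff_real has_sum_cmult_right S_has_sum \<eta>_has_sum) auto
  fix x assume x: "x \<in> Z"
  show "(x - w1) / (x ^ (N + 1) * (x - w1)) - (w1 - t) / (w2 - w1) * (1 / x ^ (N + 1))
      \<le> (x - w1) / (x ^ (N + 1) * (x - t))"
  proof (cases "x = w1")
    case True
    then show ?thesis using assms w1 w2 by simp
  next
    case False
    then have p: "x > 0" "x - w1 > 0" "x \<ge> w2" using x w1_le[OF x] w2_le[OF x] Z_pos[OF x] by auto
    have "(x - w1) / (x ^ (N + 1) * (x - w1)) - (x - w1) / (x ^ (N + 1) * (x - t))
        = (1 / x ^ (N + 1)) * ((w1 - t) / (x - t))"
      using p assms by (simp add: divide_simps)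
    also have "\<dots> \<le> (1 / x ^ (N + 1)) * ((w1 - t) / (w2 - w1))"
      using p assms w2 by (intro mult_left_mono divide_left_mono mult_pos_pos) auto
    finally show ?thesis by (simp add: mult.commute)
  qed
qed (use assms in auto)

end

section \<open>The Dini function and its zeros\<close>

text \<open>With the integrating factor, t^(\<nu>+1) u(t) has derivative t^\<nu> h(t) >= 0 and
  starts at 0; h(0) > 0 makes it increase strictly at first. Both the reality and the simplicity of
  the zeros rest on this.\<close>

lemma weighted_derivative_pos:
  fixes u u' h :: "real \<Rightarrow> real"
  assumes nu: "\<nu> > - 1" and b: "b > 0"
    and contu: "continuous_on {0..b} u" and conth: "continuous_on {0..b} h"
    and u: "\<And>t. 0 < t \<Longrightarrow> t < b \<Longrightarrow> (u has_real_derivative u' t) (at t)"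
    and eq: "\<And>t. 0 < t \<Longrightarrow> t < b \<Longrightarrow> (\<nu> + 1) * u t + t * u' t = h t"
    and h: "\<And>t. h t \<ge> 0" and h0: "h 0 > 0"
  shows "u b > 0"
proof -
  define g where "g = (\<lambda>t. t powr (\<nu> + 1) * u t)"
  have contg: "continuous_on {0..b} g"
    unfolding g_def using nu by (intro continuous_intros continuous_on_powr' contu) auto
  have g: "(g has_real_derivative t powr \<nu> * h t) (at t)" if "0 < t" "t < b" for t
  proof -
    have "(g has_real_derivative (\<nu> + 1) * t powr \<nu> * u t + u' t * t powr (\<nu> + 1)) (at t)"
      unfolding g_def using that by (auto intro!: derivative_eq_intros u)
    also have "(\<nu> + 1) * t powr \<nu> * u t + u' t * t powr (\<nu> + 1) = t powr \<nu> * h t"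
      using that by (simp add: powr_add eq[symmetric] algebra_simps)
    finally show ?thesis .
  qed
  have "\<exists>d>0. \<forall>t\<in>{0..b}. dist t 0 < d \<longrightarrow> dist (h t) (h 0) < h 0"
    using conth b h0 unfolding continuous_on_iff by (metis atLeastAtMost_iff less_imp_le order_refl)
  then obtain d0 where d0: "d0 > 0" "\<And>t. t \<in> {0..b} \<Longrightarrow> dist t 0 < d0 \<Longrightarrow> dist (h t) (h 0) < h 0"
    by blast
  define d where "d = min b (d0 / 2)"
  have d: "0 < d" "d \<le> b" "d < d0" using d0 b by (auto simp: d_def)
  have hpos: "h t > 0" if "0 < t" "t < d" for t
    using d0(2)[of t] that d by (auto simp: dist_real_def)
  have "g 0 < g d"
  proof (rule DERIV_pos_imp_increasing_open[OF d(1)])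
    fix t assume "0 < t" "t < d"
    then show "\<exists>y. (g has_real_derivative y) (at t) \<and> 0 < y" using g[of t] d hpos[of t] by auto
  qed (rule continuous_on_subset[OF contg], use d in auto)
  moreover have "g d \<le> g b"
  proof (rule DERIV_nonneg_imp_increasing_open[OF d(2)])
    fix t assume "d < t" "t < b"
    then show "\<exists>y. (g has_real_derivative y) (at t) \<and> 0 \<le> y"
      using g[of t] d h[of t] by (auto intro!: exI[of _ "t powr \<nu> * h t"])
  qed (rule continuous_on_subset[OF contg], use d in auto)
  ultimately have "b powr (\<nu> + 1) * u b > 0" by (simp add: g_def)
  then show ?thesis using b by (simp add: zero_less_mult_iff)
qed

text \<open>
  \<open>J\<^sub>\<nu>(x) = (x/2)\<^sup>\<nu> / \<Gamma>(\<nu> + 1) * \<Phi>(x\<^sup>2)\<close> and \<open>\<D>\<^sub>\<nu>(x) = F(x\<^sup>2)\<close> for the entire functions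
  \<open>\<Phi>\<close> and \<open>F = \<Phi> + 2 w \<Phi>'\<close> with the following Taylor coefficients.
\<close>

definition bessel_coeff :: "real \<Rightarrow> nat \<Rightarrow> real" where
  "bessel_coeff \<nu> k = (- 1 / 4) ^ k / (fact k * pochhammer (\<nu> + 1) k)"

definition dini_coeff :: "real \<Rightarrow> nat \<Rightarrow> real" where
  "dini_coeff \<nu> k = (2 * real k + 1) * bessel_coeff \<nu> k"

section \<open>Growth and differential equations of the entire functions\<close>

context
  fixes \<nu> :: real
  assumes nu: "\<nu> > - 1"
begin

lemma pochhammer_nu_pos: "pochhammer (\<nu> + 1) k > 0"
  using nu by (intro pochhammer_pos) simp

lemma bessel_coeff_eq: "bessel_coeff \<nu> k = (- 1) ^ k / (4 ^ k * (fact k * pochhammer (\<nu> + 1) k))"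
  unfolding bessel_coeff_def power_divide by simp

lemma abs_dini_coeff:
  "\<bar>dini_coeff \<nu> k\<bar> = (2 * real k + 1) / (4 ^ k * (fact k * pochhammer (\<nu> + 1) k))"
  using pochhammer_nu_pos[of k] by (simp add: dini_coeff_def bessel_coeff_eq abs_mult power_abs)

text \<open>The Pochhammer symbol outgrows every geometric sequence: the quotient \<open>v\<close>
  of the two sides is eventually nonincreasing, hence bounded.\<close>

lemma dini_coeff_bound:
  assumes "\<epsilon> > 0"
  obtains C where "\<And>k. \<bar>dini_coeff \<nu> k\<bar> \<le> C * \<epsilon> ^ k / fact k"
proof -
  define v where "v = (\<lambda>k. (2 * real k + 1) / (4 ^ k * pochhammer (\<nu> + 1) k * \<epsilon> ^ k))"
  have vpos: "v k > 0" for k using pochhammer_nu_pos[of k] assms by (simp add: v_def)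
  \<comment> \<open>From this index on 4 (\<nu> + 1 + k) \<epsilon> >= 3, so the ratio of
    consecutive terms of \<open>v\<close> is at most (2k + 3) / (3 (2k + 1)) <= 1.\<close>
  define K where "K = nat \<lceil>3 / (4 * \<epsilon>) + 1\<rceil>"
  have step: "v (Suc k) \<le> v k" if "k \<ge> K" for k
  proof -
    have k: "real k \<ge> 3 / (4 * \<epsilon>) + 1" using that unfolding K_def by linarith
    have "v (Suc k) = (2 * real k + 3) / (4 * (\<nu> + 1 + real k) * \<epsilon>) * (1 / (4 ^ k * pochhammer (\<nu> + 1) k * \<epsilon> ^ k))"
      by (simp add: v_def pochhammer_Suc mult.commute mult.left_commute add.commute)
    also have "(2 * real k + 3) / (4 * (\<nu> + 1 + real k) * \<epsilon>) \<le> 2 * real k + 1"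
    proof -
      have "3 \<le> 4 * \<epsilon> * (real k)" using k assms by (simp add: field_simps)
      also have "\<dots> \<le> 4 * (\<nu> + 1 + real k) * \<epsilon>" using nu assms by simp
      finally have D: "3 \<le> 4 * (\<nu> + 1 + real k) * \<epsilon>" .
      have "(2 * real k + 3) / (4 * (\<nu> + 1 + real k) * \<epsilon>) \<le> (2 * real k + 3) / 3"
        by (rule divide_left_mono) (use D in auto)
      also have "\<dots> \<le> 2 * real k + 1" by simp
      finally show ?thesis .
    qed
    also have "(2 * real k + 1) * (1 / (4 ^ k * pochhammer (\<nu> + 1) k * \<epsilon> ^ k)) = v k"
      by (simp add: v_def)
    finally show ?thesis
      using pochhammer_nu_pos[of k] assms by (simp add: divide_right_mono less_imp_le)
  qed
  have "Bseq (\<lambda>n. v (n + K))"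
  proof (rule BseqI')
    fix n
    have "v (n + K) \<le> v K" by (induction n) (use step in \<open>auto intro: order_trans[OF step]\<close>)
    then show "norm (v (n + K)) \<le> v K" using vpos[of "n + K"] by simp
  qed
  then have "Bseq v" by (rule Bseq_offset)
  then obtain C where C: "\<And>k. norm (v k) \<le> C" unfolding Bseq_def by auto
  have "\<bar>dini_coeff \<nu> k\<bar> \<le> C * \<epsilon> ^ k / fact k" for k
  proof -
    have "\<bar>dini_coeff \<nu> k\<bar> = v k * (\<epsilon> ^ k / fact k)"
      using pochhammer_nu_pos[of k] assms by (simp add: abs_dini_coeff v_def)
    also have "\<dots> \<le> C * (\<epsilon> ^ k / fact k)"
      using C[of k] assms by (intro mult_right_mono) auto
    finally show ?thesis by simp
  qed
  then show ?thesis using that by blast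
qed

lemma entire_dini_coeff: "entire_coeffs (dini_coeff \<nu>)"
  using dini_coeff_bound[of 1] entire_coeffs_if_le by (metis zero_less_one)

lemma entire_bessel_coeff: "entire_coeffs (bessel_coeff \<nu>)"
proof -
  obtain C where C: "\<And>k. \<bar>dini_coeff \<nu> k\<bar> \<le> C * 1 ^ k / fact k" using dini_coeff_bound[of 1] by auto
  have "\<bar>bessel_coeff \<nu> k\<bar> \<le> \<bar>dini_coeff \<nu> k\<bar>" for k
    by (simp add: dini_coeff_def abs_mult mult_le_cancel_right1)
  then show ?thesis using C entire_coeffs_if_le order_trans by metis
qed

private abbreviation Phi :: "'a::{real_normed_field,banach} \<Rightarrow> 'a" where
  "Phi \<equiv> power_series (bessel_coeff \<nu>)"
private abbreviation Phi' :: "'a::{real_normed_field,banach} \<Rightarrow> 'a" where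
  "Phi' \<equiv> power_series (diffs (bessel_coeff \<nu>))"
private abbreviation Phi'' :: "'a::{real_normed_field,banach} \<Rightarrow> 'a" where
  "Phi'' \<equiv> power_series (diffs (diffs (bessel_coeff \<nu>)))"
private abbreviation F :: "'a::{real_normed_field,banach} \<Rightarrow> 'a" where
  "F \<equiv> power_series (dini_coeff \<nu>)"

lemmas Phi_deriv = power_series_has_field_derivative[OF entire_bessel_coeff]
lemmas Phi'_deriv = power_series_has_field_derivative[OF entire_coeffs_diffs[OF entire_bessel_coeff]]

text \<open>Bessel's equation in the variable w = x^2, obtained from the recurrence (n + 1) (\<nu> +
  1 + n) a(n+1) = - a(n) / 4. It is solved for \<open>w * Phi'' w\<close> so that it can eliminate
  the second derivative by rewriting.\<close>

lemma bessel_ode: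
  fixes w :: "'a::{real_normed_field,banach}"
  shows "w * Phi'' w = - (of_real (\<nu> + 1) * Phi' w) - Phi w / 4"
proof -
  let ?a = "bessel_coeff \<nu>"
  note E = entire_bessel_coeff entire_coeffs_diffs[OF entire_bessel_coeff]
  have coeff: "real n * diffs ?a n + (\<nu> + 1) * diffs ?a n + 1 / 4 * ?a n = 0" for n
  proof -
    have "(\<nu> + 1 + real n) \<noteq> 0" using nu by simp
    have "real n * diffs ?a n + (\<nu> + 1) * diffs ?a n = (\<nu> + 1 + real n) * diffs ?a n"
      by (simp add: algebra_simps)
    also have "\<dots> = - 1 / 4 * ?a n"
      using pochhammer_nu_pos[of n] \<open>(\<nu> + 1 + real n) \<noteq> 0\<close>
      by (simp add: diffs_def bessel_coeff_def pochhammer_Suc del: of_nat_Suc)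
    finally show ?thesis by simp
  qed
  have "w * Phi'' w + of_real (\<nu> + 1) * Phi' w + of_real (1/4) * Phi w
      = power_series (\<lambda>n. real n * diffs ?a n + (\<nu> + 1) * diffs ?a n + 1 / 4 * ?a n) w"
    by (simp only: power_series_mult_diffs E power_series_cmult power_series_add
        entire_coeffs_add entire_coeffs_cmult)
  also have "\<dots> = 0" unfolding coeff by (simp add: power_series_def)
  finally have "w * Phi'' w + (of_real (\<nu> + 1) * Phi' w + Phi w / 4) = 0" by (simp add: add.assoc)
  then show ?thesis by (simp only: add_eq_0_iff2 minus_add_distrib diff_conv_add_uminus)
qed

lemma F_eq:
  fixes w :: "'a::{real_normed_field,banach}"
  shows "F w = Phi w + 2 * w * Phi' w"
proof -
  let ?a = "bessel_coeff \<nu>"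
  note E = entire_bessel_coeff entire_coeffs_diffs[OF entire_bessel_coeff]
  have "Phi w + of_real 2 * (w * Phi' w) = power_series (\<lambda>n. ?a n + 2 * (real n * ?a n)) w"
    by (simp only: power_series_mult_diffs E power_series_cmult power_series_add
        entire_coeffs_add entire_coeffs_cmult)
  also have "(\<lambda>n. ?a n + 2 * (real n * ?a n)) = dini_coeff \<nu>"
    by (auto simp: dini_coeff_def algebra_simps)
  finally show ?thesis by (simp add: mult.assoc)
qed

text \<open>Differentiating \<Phi> + 2 w \<Phi>' gives 3 \<Phi>' + 2 w \<Phi>'', and
  \<open>bessel_ode\<close> removes the second derivative.\<close>

lemma F_deriv:
  fixes w :: "'a::{real_normed_field,banach}"
  shows "(F has_field_derivative of_real (1 - 2 * \<nu>) * Phi' w - Phi w / 2) (at w)"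
proof -
  have "((\<lambda>w. Phi w + 2 * w * Phi' w) has_field_derivative
      Phi' w + (2 * Phi' w + Phi'' w * (2 * w))) (at w)"
    by (auto intro!: derivative_eq_intros Phi_deriv Phi'_deriv)
  also have "(\<lambda>w. Phi w + 2 * w * Phi' w) = (F :: 'a \<Rightarrow> 'a)" by (rule ext) (simp add: F_eq)
  also have "Phi'' w * (2 * w) = 2 * (w * Phi'' w)" by simp
  also have "Phi' w + (2 * Phi' w + 2 * (w * Phi'' w)) = of_real (1 - 2 * \<nu>) * Phi' w - Phi w / 2"
    unfolding bessel_ode by (simp add: algebra_simps)
  finally show ?thesis .
qed

lemma F_holomorphic: "F holomorphic_on UNIV"
  using F_deriv by (auto simp: holomorphic_on_def field_differentiable_def intro: has_field_derivative_at_within)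

lemma F_0: "F 0 = (1 :: 'a::{real_normed_field,banach})"
  and Phi_0: "Phi 0 = (1 :: 'a)"
  by (simp_all add: power_series_0 dini_coeff_def bessel_coeff_def)

lemma F_growth:
  assumes "\<epsilon> > 0"
  shows "\<exists>C. \<forall>w :: complex. norm (F w) \<le> C * exp (\<epsilon> * norm w)"
  using power_series_norm_le[OF entire_dini_coeff] dini_coeff_bound[OF assms] by metis

lemma F_of_real: "F (of_real x :: complex) = of_real (F x)"
  by (rule power_series_of_real[OF entire_dini_coeff])

lemma dini_coeff_uminus_power: "dini_coeff \<nu> k * (- r) ^ k = \<bar>dini_coeff \<nu> k\<bar> * r ^ k"
proof -
  have "(- r) ^ k = (- 1) ^ k * r ^ k" by (rule power_minus)
  moreover have "(- 1 :: real) ^ k * (- 1) ^ k = 1" by (simp flip: power_mult_distrib)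
  then have "dini_coeff \<nu> k * (- 1) ^ k = \<bar>dini_coeff \<nu> k\<bar>"
    unfolding abs_dini_coeff by (simp add: dini_coeff_def bessel_coeff_eq mult.assoc)
  ultimately show ?thesis by (simp add: mult.assoc[symmetric])
qed

text \<open>The coefficients alternate in sign, so at a negative argument all terms are nonnegative
  and any single one bounds the sum from below.\<close>

lemma F_uminus_ge:
  assumes "r \<ge> 0"
  shows "F (- r) \<ge> \<bar>dini_coeff \<nu> k\<bar> * r ^ k"
proof -
  have "sum (\<lambda>n. dini_coeff \<nu> n * (- r) ^ n) {k} \<le> (\<Sum>n. dini_coeff \<nu> n * (- r) ^ n)"
    by (rule sum_le_suminf)
     (use entire_coeffs_summable[OF entire_dini_coeff, of "-r"] assms in \<open>auto simp: dini_coeff_uminus_power\<close>)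
  then show ?thesis by (simp add: power_series_def dini_coeff_uminus_power)
qed

lemma F_nonpos_ge_1:
  assumes "x \<le> 0"
  shows "F x \<ge> (1 :: real)"
  using F_uminus_ge[of "- x" 0] assms by (simp add: dini_coeff_def bessel_coeff_def)

section \<open>Reality, positivity and simplicity of the zeros\<close>

lemma Phi_continuous: "continuous_on S (Phi :: 'a::{real_normed_field,banach} \<Rightarrow> 'a)"
  and Phi'_continuous: "continuous_on S (Phi' :: 'a \<Rightarrow> 'a)"
  by (rule DERIV_continuous_on, rule has_field_derivative_at_within, rule Phi_deriv Phi'_deriv)+

text \<open>
  Green's identity for \<open>(t\<^sup>\<nu>\<^sup>+\<^sup>1 y')' = - (w / 4) t\<^sup>\<nu> y\<close> with \<open>y(t) = \<Phi>(w t)\<close>: the boundary term of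
  \<open>y\<close> and its conjugate vanishes at \<open>0\<close>, and at \<open>1\<close> if \<open>F(w) = 0\<close>, so \<open>Im w \<integral> t\<^sup>\<nu> |y|\<^sup>2 = 0\<close>.
\<close>
lemma F_zero_imp_real:
  fixes w :: complex
  assumes "F w = 0"
  shows "Im w = 0"
proof (rule ccontr)
  assume im: "Im w \<noteq> 0"
  define y where "y = (\<lambda>t :: real. Phi (w * of_real t))"
  define q where "q = (\<lambda>t :: real. w * Phi' (w * of_real t))"
  define q' where "q' = (\<lambda>t :: real. w * (w * Phi'' (w * of_real t)))"
  have y: "(y has_vector_derivative q t) (at t)" for t
    unfolding y_def q_def
    by (rule has_vector_derivative_real_field)
      (rule DERIV_chain'[where g = Phi, OF _ Phi_deriv, THEN DERIV_cong],
        auto intro!: derivative_eq_intros)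
  have q: "(q has_vector_derivative q' t) (at t)" for t
    unfolding q_def q'_def
    by (rule has_vector_derivative_real_field, rule DERIV_cmult)
      (rule DERIV_chain'[where g = Phi', OF _ Phi'_deriv, THEN DERIV_cong],
        auto intro!: derivative_eq_intros)
  have ode: "of_real t * q' t = - (of_real (\<nu> + 1) * q t) - w * y t / 4" for t
  proof -
    have "of_real t * q' t = w * ((w * of_real t) * Phi'' (w * of_real t))" by (simp add: q'_def)
    then show ?thesis unfolding bessel_ode by (simp add: q_def y_def algebra_simps)
  qed
  \<comment> \<open>Dividing by - Im w makes the right-hand side of the weighted equation |y|^2 / 4,
    whatever the sign of Im w.\<close>
  define u where "u = (\<lambda>t. - Im (q t * cnj (y t)) / Im w)"
  have "u 1 > 0"
  proof (rule weighted_derivative_pos[OF nu zero_less_one])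
    show "continuous_on {0..1} u"
      unfolding u_def q_def y_def using im
      by (intro continuous_intros continuous_on_compose2[OF Phi_continuous[of UNIV]]
          continuous_on_compose2[OF Phi'_continuous[of UNIV]]) auto
    show "continuous_on {0..1} (\<lambda>t. (norm (y t))\<^sup>2 / 4)"
      unfolding y_def by (intro continuous_intros continuous_on_compose2[OF Phi_continuous[of UNIV]]) auto
    show "(norm (y 0))\<^sup>2 / 4 > 0" by (simp add: y_def Phi_0)
    fix t :: real
    have "((\<lambda>t. q t * cnj (y t)) has_vector_derivative q t * cnj (q t) + q' t * cnj (y t)) (at t)"
      by (intro has_vector_derivative_mult has_vector_derivative_cnj y q)
    from bounded_linear.has_vector_derivative[OF bounded_linear_Im this]
    have "((\<lambda>t. Im (q t * cnj (y t))) has_real_derivative Im (q t * cnj (q t) + q' t * cnj (y t))) (at t)"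
      by (simp add: has_real_derivative_iff_has_vector_derivative)
    moreover have "Im (q t * cnj (q t) + q' t * cnj (y t)) = Im (q' t * cnj (y t))" by simp
    ultimately have "((\<lambda>t. Im (q t * cnj (y t))) has_real_derivative Im (q' t * cnj (y t))) (at t)"
      by (simp only:)
    then show "(u has_real_derivative - Im (q' t * cnj (y t)) / Im w) (at t)"
      unfolding u_def by (intro DERIV_cdivide DERIV_minus)
    have "Im (of_real t * z) = t * Im z" for z by simp
    then have "t * Im (q' t * cnj (y t)) = Im ((of_real t * q' t) * cnj (y t))"
      by (simp only: mult.assoc)
    also have "\<dots> = - (\<nu> + 1) * Im (q t * cnj (y t)) - Im (w * (y t * cnj (y t))) / 4"
      unfolding ode by (simp add: algebra_simps)
    also have "Im (w * (y t * cnj (y t))) = Im w * (norm (y t))\<^sup>2"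
      by (simp add: complex_norm_square[symmetric])
    finally have "t * Im (q' t * cnj (y t)) = - (\<nu> + 1) * Im (q t * cnj (y t)) - Im w * (norm (y t))\<^sup>2 / 4" .
    moreover have "(\<nu> + 1) * (- Y / c) + t * (- X / c) = n / 4"
      if "t * X = - (\<nu> + 1) * Y - c * n / 4" "c \<noteq> 0" for X Y c n :: real
    proof -
      have "(\<nu> + 1) * (- Y / c) + t * (- X / c) = - ((\<nu> + 1) * Y + t * X) / c"
        using that(2) by (simp add: field_simps)
      also have "(\<nu> + 1) * Y + t * X = - (c * n / 4)" using that(1) by (simp add: algebra_simps)
      finally show ?thesis using that(2) by simp
    qed
    ultimately show "(\<nu> + 1) * u t + t * (- Im (q' t * cnj (y t)) / Im w) = (norm (y t))\<^sup>2 / 4"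
      unfolding u_def using im by blast
  qed simp
  \<comment> \<open>F(w) = 0 says w \<Phi>'(w) = - \<Phi>(w) / 2, so q(1) times the conjugate of
    y(1) is real and \<open>u\<close> vanishes at 1.\<close>
  moreover have "q 1 = - y 1 / 2"
    using assms F_eq[of w] by (simp add: q_def y_def eq_neg_iff_add_eq_0 field_simps)
  then have "u 1 = 0" by (simp add: u_def)
  ultimately show False by simp
qed

lemma F_zero_imp_pos_real:
  fixes w :: complex
  assumes "F w = 0"
  shows "w = of_real (Re w)" "Re w > 0" "F (Re w) = 0"
proof -
  show w: "w = of_real (Re w)" using F_zero_imp_real[OF assms] by (simp add: complex_eq_iff)
  have "of_real (F (Re w)) = (0 :: complex)"
    unfolding F_of_real[symmetric] w[symmetric] by (rule assms)
  then show "F (Re w) = 0" by simp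
  then show "Re w > 0" using F_nonpos_ge_1[of "Re w"] by (cases "Re w \<le> 0") auto
qed

text \<open>
  If \<open>F(x) = F'(x) = 0\<close>, the Wronskian of \<open>y(t) = \<Phi>(x t)\<close> and its derivative in \<open>x\<close>, which is
  \<open>\<integral> t\<^sup>\<nu> y\<^sup>2 / 4\<close> up to a power of \<open>x\<close>, would vanish at the endpoint.
\<close>
lemma F_zeros_simple:
  fixes w :: complex
  assumes "F w = 0"
  shows "deriv F w \<noteq> 0"
proof
  assume d: "deriv F w = 0"
  define x where "x = Re w"
  have x: "w = of_real x" "x > 0" "F x = 0" using F_zero_imp_pos_real[OF assms] by (simp_all add: x_def)
  have 1: "Phi x = - 2 * x * Phi' x" using F_eq[of x] x by simp
  have "of_real (1 - 2 * \<nu>) * Phi' w - Phi w / 2 = 0" using DERIV_imp_deriv[OF F_deriv[of w]] d by simp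
  then have "complex_of_real ((1 - 2 * \<nu>) * Phi' x - Phi x / 2) = 0"
    unfolding x(1) power_series_of_real[OF entire_bessel_coeff]
      power_series_of_real[OF entire_coeffs_diffs[OF entire_bessel_coeff]] by simp
  then have 2: "(1 - 2 * \<nu>) * Phi' x - Phi x / 2 = 0" by (simp only: of_real_eq_0_iff)
  define E where "E = (\<lambda>t. t * (Phi' t)\<^sup>2 + \<nu> * Phi t * Phi' t + (Phi t)\<^sup>2 / 4 :: real)"
  define E' where "E' = (\<lambda>t. (Phi' t)\<^sup>2 + 2 * Phi' t * (t * Phi'' t) + \<nu> * (Phi' t)\<^sup>2
    + \<nu> * Phi t * Phi'' t + Phi t * Phi' t / 2 :: real)"
  have "E x > 0"
  proof (rule weighted_derivative_pos[OF nu x(2)])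
    show "continuous_on {0..x} E"
      unfolding E_def by (intro continuous_intros Phi_continuous Phi'_continuous) auto
    show "continuous_on {0..x} (\<lambda>t. (Phi t)\<^sup>2 / 4)" by (intro continuous_intros Phi_continuous) auto
    show "(Phi 0)\<^sup>2 / 4 > (0 :: real)" by (simp add: Phi_0)
    fix t :: real
    show "(E has_real_derivative E' t) (at t)"
      unfolding E_def E'_def
      by (auto intro!: derivative_eq_intros Phi_deriv Phi'_deriv
          simp: power2_eq_square algebra_simps)
    have "t * E' t = t * (Phi' t)\<^sup>2 + 2 * t * Phi' t * (t * Phi'' t) + t * \<nu> * (Phi' t)\<^sup>2
      + \<nu> * Phi t * (t * Phi'' t) + t * Phi t * Phi' t / 2"
      by (simp add: E'_def algebra_simps)
    then show "(\<nu> + 1) * E t + t * E' t = (Phi t)\<^sup>2 / 4"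
      unfolding bessel_ode by (simp add: E_def power2_eq_square field_simps)
  qed simp
  \<comment> \<open>Substituting \<Phi>(x) = - 2 x \<Phi>'(x), that is F(x) = 0, makes E(x) a
    multiple of F'(x).\<close>
  moreover have "E x = x * Phi' x * ((1 - 2 * \<nu>) * Phi' x - Phi x / 2)"
    unfolding E_def 1 by (simp add: power2_eq_square algebra_simps)
  ultimately show False using 2 by simp
qed

section \<open>Bessel and Dini functions in terms of the entire functions\<close>

lemma bessel_J_eq:
  assumes "x > 0"
  shows "bessel_J \<nu> x = rGamma (\<nu> + 1) * (x / 2) powr \<nu> * Phi (x\<^sup>2)"
proof -
  have "(- 1) ^ k / fact k * rGamma (\<nu> + real k + 1) * (x / 2) powr (2 * real k + \<nu>)
      = rGamma (\<nu> + 1) * (x / 2) powr \<nu> * (bessel_coeff \<nu> k * (x\<^sup>2) ^ k)" for k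
  proof -
    have "rGamma (\<nu> + 1) = pochhammer (\<nu> + 1) k * rGamma (\<nu> + real k + 1)"
      using pochhammer_rGamma[of "\<nu> + 1" k] by (simp add: add_ac)
    moreover have "(x / 2) powr (2 * real k + \<nu>) = (x\<^sup>2 / 4) ^ k * (x / 2) powr \<nu>"
      using assms powr_realpow[of "x / 2" "2 * k"]
      by (simp add: powr_add power_mult power_divide)
    ultimately show ?thesis
      using pochhammer_nu_pos[of k] by (simp add: bessel_coeff_eq power_divide mult_ac)
  qed
  then show ?thesis
    unfolding bessel_J_def power_series_def
    using suminf_mult[OF entire_coeffs_summable[OF entire_bessel_coeff, of "x\<^sup>2"],
        of "rGamma (\<nu> + 1) * (x / 2) powr \<nu>"] by simp
qed

text \<open>Differentiating the power factor of J contributes \<nu> J to x J', which cancels against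
  (1 - \<nu>) J and leaves \<Phi> + 2 x^2 \<Phi>' at x^2, that is \<open>F\<close>.\<close>

lemma dini_eq:
  assumes "x > 0"
  shows "dini \<nu> x = rGamma (\<nu> + 1) * (x / 2) powr \<nu> * F (x\<^sup>2)"
proof -
  define c where "c = rGamma (\<nu> + 1)"
  have "((\<lambda>x. c * (x / 2) powr \<nu> * Phi (x\<^sup>2)) has_real_derivative
      c * (\<nu> * (x / 2) powr (\<nu> - 1) / 2) * Phi (x\<^sup>2) + (Phi' (x\<^sup>2) * (2 * x)) * (c * (x / 2) powr \<nu>)) (at x)"
    using assms
    by (auto intro!: derivative_eq_intros DERIV_chain'[where g = Phi, OF _ Phi_deriv])
  also have "(x / 2) powr (\<nu> - 1) = (x / 2) powr \<nu> * 2 / x"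
    using assms by (simp add: powr_diff)
  finally have "(bessel_J \<nu> has_real_derivative
      c * (\<nu> * ((x / 2) powr \<nu> * 2 / x) / 2) * Phi (x\<^sup>2) + (Phi' (x\<^sup>2) * (2 * x)) * (c * (x / 2) powr \<nu>)) (at x)"
    by (rule has_field_derivative_transform_within_open[where S = "{0<..}"])
      (use assms bessel_J_eq in \<open>auto simp: c_def\<close>)
  then have "deriv (bessel_J \<nu>) x = c * (x / 2) powr \<nu> * (\<nu> / x * Phi (x\<^sup>2) + 2 * x * Phi' (x\<^sup>2))"
    using assms by (subst DERIV_imp_deriv) (auto simp: field_simps)
  then show ?thesis
    unfolding dini_def bessel_J_eq[OF assms] F_eq
    using assms by (simp add: c_def power2_eq_square field_simps)
qed

lemma Gamma_nu_nonzero: "Gamma (\<nu> + 1) \<noteq> 0"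
  using Gamma_real_pos[of "\<nu> + 1"] nu by linarith

lemma dini_normalized_eq: "dini_normalized \<nu> x = F (x\<^sup>2)"
proof (cases "x = 0")
  case False
  have "dini_normalized \<nu> x = 2 powr \<nu> * Gamma (\<nu> + 1) * \<bar>x\<bar> powr (- \<nu>) *
      (inverse (Gamma (\<nu> + 1)) * (\<bar>x\<bar> powr \<nu> / 2 powr \<nu>) * F (x\<^sup>2))"
    using False dini_eq[of "\<bar>x\<bar>"] by (simp add: dini_normalized_def rGamma_inverse_Gamma powr_divide)
  then show ?thesis using False Gamma_nu_nonzero by (simp add: powr_minus field_simps)
qed (simp add: dini_normalized_def F_0)

lemma dini_normalized_log_deriv:
  "deriv (dini_normalized \<nu>) x / dini_normalized \<nu> x = 2 * x * (deriv F (x\<^sup>2) / F (x\<^sup>2))"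
proof -
  have "(F has_real_derivative deriv F (x\<^sup>2)) (at (x\<^sup>2))"
    using F_deriv[of "x\<^sup>2"] DERIV_imp_deriv by metis
  then have "((\<lambda>x. F (x\<^sup>2)) has_real_derivative deriv F (x\<^sup>2) * (2 * x)) (at x)"
    by (auto intro!: derivative_eq_intros DERIV_chain'[where g = F])
  moreover have "(\<lambda>x. F (x\<^sup>2)) = dini_normalized \<nu>" using dini_normalized_eq by auto
  ultimately have "deriv (dini_normalized \<nu>) x = deriv F (x\<^sup>2) * (2 * x)" using DERIV_imp_deriv by metis
  then show ?thesis by (simp add: dini_normalized_eq)
qed

lemma dini_eq_0_iff:
  assumes "x > 0"
  shows "dini \<nu> x = 0 \<longleftrightarrow> F (x\<^sup>2) = 0"
  using dini_eq[OF assms] assms Gamma_nu_nonzero by (simp add: rGamma_inverse_Gamma)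

lemma F_zero_pos:
  fixes x :: real
  assumes "F x = 0"
  shows "x > 0"
  using F_nonpos_ge_1[of x] assms by (cases "x \<le> 0") auto

section \<open>Enumeration of the zeros and partial fractions\<close>

private abbreviation Z :: "real set" where "Z \<equiv> {x. F x = 0}"

lemma complex_zeros_le: "{w :: complex. F w = 0 \<and> norm w \<le> R} = of_real ` {x \<in> Z. x \<le> R}"
proof (intro equalityI subsetI)
  fix w :: complex assume w: "w \<in> {w. F w = 0 \<and> norm w \<le> R}"
  then have "F w = 0" by simp
  note r = F_zero_imp_pos_real[OF this]
  have "norm w = Re w" by (subst r(1)) (use r(2) in simp)
  then show "w \<in> of_real ` {x \<in> Z. x \<le> R}" using r w by (intro image_eqI[where x = "Re w"]) simp_all
next
  fix w :: complex assume "w \<in> of_real ` {x \<in> Z. x \<le> R}"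
  then obtain x where x: "w = of_real x" "F x = 0" "x \<le> R" by auto
  then show "w \<in> {w. F w = 0 \<and> norm w \<le> R}"
    using F_zero_pos[OF x(2)] F_of_real[of x] by simp
qed

lemma finite_Z_le: "finite {x \<in> Z. x \<le> R}"
proof -
  have "\<not> F constant_on (UNIV :: complex set)" if "F w = 0" for w :: complex
    using that F_0[where 'a = complex] by (metis UNIV_I constant_on_def zero_neq_one)
  then have "finite {w \<in> cball 0 R. F w = (0 :: complex)}"
    using holomorphic_compact_finite_zeros[OF F_holomorphic, of "cball 0 R"]
    by (cases "\<exists>w :: complex. F w = 0") auto
  then have "finite {w :: complex. F w = 0 \<and> norm w \<le> R}" by (rule rev_finite_subset) auto
  then show ?thesis unfolding complex_zeros_le by (rule finite_imageD) (auto intro: inj_onI)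
qed

text \<open>All complex zeros are real and positive, so the complex limit over discs is a real limit
  over initial segments of \<open>Z\<close>.\<close>

lemma log_deriv_tendsto:
  assumes "F t \<noteq> (0 :: real)"
  shows "((\<lambda>R. \<Sum>x | x \<in> Z \<and> x \<le> R. 1 / (x - t)) \<longlongrightarrow> - deriv F t / F t) at_top"
proof -
  have D: "deriv F (of_real t) = complex_of_real (deriv F t)"
    unfolding DERIV_imp_deriv[OF F_deriv]
    by (simp add: power_series_of_real entire_bessel_coeff entire_coeffs_diffs)
  have "((\<lambda>R. \<Sum>w | F w = 0 \<and> norm w \<le> R. 1 / (complex_of_real t - w)) \<longlongrightarrow>
      deriv F (of_real t) / F (of_real t)) at_top"
    by (rule log_deriv_eq_lim_sum_zeros)
      (use assms F_holomorphic F_0 F_zeros_simple F_growth F_of_real in auto)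
  moreover have "(\<Sum>w | F w = 0 \<and> norm w \<le> R. 1 / (complex_of_real t - w))
      = of_real (- (\<Sum>x | x \<in> Z \<and> x \<le> R. 1 / (x - t)))" for R
  proof -
    have "- (\<Sum>x | x \<in> Z \<and> x \<le> R. 1 / (x - t)) = (\<Sum>x | x \<in> Z \<and> x \<le> R. 1 / (t - x))"
      unfolding sum_negf[symmetric] by (intro sum.cong refl) (simp add: divide_simps)
    then show ?thesis
      unfolding complex_zeros_le by (subst sum.reindex) (auto intro: inj_onI)
  qed
  ultimately have "((\<lambda>R. complex_of_real (- (\<Sum>x | x \<in> Z \<and> x \<le> R. 1 / (x - t)))) \<longlongrightarrow>
      complex_of_real (deriv F t / F t)) at_top"
    by (simp only: D F_of_real of_real_divide)
  then have "((\<lambda>R. - (\<Sum>x | x \<in> Z \<and> x \<le> R. 1 / (x - t))) \<longlongrightarrow> deriv F t / F t) at_top"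
    by (simp only: tendsto_of_real_iff)
  from tendsto_minus[OF this] show ?thesis by simp
qed

text \<open>With only N zeros, the partial fractions would force F(-r) to grow at most like r^N, but
  \<open>F_uminus_ge\<close> bounds it below by the term of degree N + 1.\<close>

lemma infinite_Z: "infinite Z"
proof
  assume fin: "finite Z"
  define N where "N = card Z"
  have Fpos: "F (- r) > (0 :: real)" if "r > 0" for r :: real
    using F_nonpos_ge_1[of "- r"] that by simp
  have log_deriv: "- deriv F (- r) / F (- r) \<le> real N / r" if r: "r > 0" for r
  proof -
    have "- deriv F (- r) / F (- r) = (\<Sum>x\<in>Z. 1 / (x + r))"
    proof (rule tendsto_unique[OF _ log_deriv_tendsto])
      have "\<forall>\<^sub>F R in at_top. \<forall>x\<in>Z. x \<le> R"
        using fin by (intro eventually_ball_finite) (auto intro: eventually_ge_at_top)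
      then have "\<forall>\<^sub>F R in at_top. (\<Sum>x | x \<in> Z \<and> x \<le> R. 1 / (x - - r)) = (\<Sum>x\<in>Z. 1 / (x + r))"
        by eventually_elim (intro sum.cong, auto)
      then show "((\<lambda>R. \<Sum>x | x \<in> Z \<and> x \<le> R. 1 / (x - - r)) \<longlongrightarrow> (\<Sum>x\<in>Z. 1 / (x + r))) at_top"
        by (rule tendsto_eventually)
    qed (use Fpos[OF r] in auto)
    also have "\<dots> \<le> (\<Sum>x\<in>Z. 1 / r)"
      using r F_zero_pos by (intro sum_mono divide_left_mono mult_pos_pos) (auto intro: add_pos_pos less_imp_le)
    finally show ?thesis by (simp add: N_def)
  qed
  have bound: "F (- r) \<le> F (- 1) * r ^ N" if "r \<ge> 1" for r :: real
  proof -
    \<comment> \<open>The logarithmic derivative of F(-x) is at most N/x, so F(-x) / x^N is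
      nonincreasing for x >= 1.\<close>
    have "F (- r) / r ^ N \<le> F (- 1) / 1 ^ N"
    proof (rule DERIV_nonpos_imp_nonincreasing[OF that])
      fix x :: real assume x: "1 \<le> x" "x \<le> r"
      have dF: "(F has_real_derivative deriv F (- x)) (at (- x))"
        using F_deriv DERIV_imp_deriv by metis
      have "((\<lambda>x. F (- x)) has_real_derivative deriv F (- x) * (- 1)) (at x)"
        by (rule DERIV_chain'[where f = uminus and g = F, OF _ dF]) (auto intro!: derivative_eq_intros)
      moreover have "((\<lambda>x. x ^ N) has_real_derivative real N * x ^ N / x) (at x)"
        using x by (auto intro!: derivative_eq_intros) (cases N; simp)
      ultimately have "((\<lambda>x. F (- x) / x ^ N) has_real_derivative
          (deriv F (- x) * (- 1) * x ^ N - F (- x) * (real N * x ^ N / x)) / (x ^ N * x ^ N)) (at x)"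
        using x by (intro DERIV_divide) auto
      moreover have "(deriv F (- x) * (- 1) * x ^ N - F (- x) * (real N * x ^ N / x)) / (x ^ N * x ^ N)
          = F (- x) / x ^ N * (- deriv F (- x) / F (- x) - real N / x)"
        using x Fpos[of x] by (simp add: field_simps)
      moreover have "F (- x) / x ^ N * (- deriv F (- x) / F (- x) - real N / x) \<le> 0"
        using x Fpos[of x] log_deriv[of x] by (intro mult_nonneg_nonpos) auto
      ultimately show "\<exists>y. ((\<lambda>x. F (- x) / x ^ N) has_real_derivative y) (at x) \<and> y \<le> 0" by auto
    qed
    then show ?thesis using that by (simp add: divide_simps)
  qed
  define c where "c = \<bar>dini_coeff \<nu> (Suc N)\<bar>"
  have c: "c > 0" using pochhammer_nu_pos[of "Suc N"]
    by (simp add: c_def dini_coeff_def bessel_coeff_def del: of_nat_Suc)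
  \<comment> \<open>Large enough that c r exceeds F(-1), and at least 1 so that \<open>bound\<close>
    applies.\<close>
  define r where "r = max 1 (F (- 1) / c + 1)"
  have "c * r ^ Suc N \<le> F (- r)" using F_uminus_ge[of r "Suc N"] by (simp add: c_def r_def)
  also have "\<dots> \<le> F (- 1) * r ^ N" by (rule bound) (simp add: r_def)
  finally have "c * r \<le> F (- 1)" by (simp add: r_def)
  moreover have "F (- 1) / c < r" by (simp add: r_def)
  then have "F (- 1) < c * r" using c by (simp add: field_simps)
  ultimately show False by simp
qed

lemma sqrt_image_Z: "bij_betw (\<lambda>y. y\<^sup>2) {y. 0 < y \<and> dini \<nu> y = 0} Z"
  by (rule bij_betw_byWitness[of _ sqrt])
    (use F_zero_pos dini_eq_0_iff in \<open>auto simp: less_imp_le\<close>)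

lemma dini_zero_bij: "bij_betw (dini_zero \<nu>) {1..} {y. 0 < y \<and> dini \<nu> y = 0}" (is "bij_betw _ _ ?P")
  and dini_zero_1_le: "0 < y \<Longrightarrow> dini \<nu> y = 0 \<Longrightarrow> dini_zero \<nu> 1 \<le> y"
proof -
  have inf: "infinite ?P" using bij_betw_finite[OF sqrt_image_Z] infinite_Z by simp
  have fin: "finite {y \<in> ?P. y \<le> x}" for x
  proof (rule finite_imageD)
    show "finite ((\<lambda>y. y\<^sup>2) ` {y \<in> ?P. y \<le> x})"
      by (rule finite_subset[OF _ finite_Z_le[of "x\<^sup>2"]])
        (auto simp: dini_eq_0_iff intro!: power_mono)
    show "inj_on (\<lambda>y. y\<^sup>2) {y \<in> ?P. y \<le> x}" by (auto intro!: inj_onI power2_eq_imp_eq)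
  qed
  have eq: "dini_zero \<nu> = (\<lambda>n. THE x. x \<in> ?P \<and> card {y \<in> ?P. y \<le> x} = n)"
    by (auto simp: dini_zero_def conj_ac)
  show "bij_betw (dini_zero \<nu>) {1..} ?P" unfolding eq by (rule bij_betw_nth_element[OF inf fin])
  show "dini_zero \<nu> 1 \<le> y" if "0 < y" "dini \<nu> y = 0"
    unfolding eq by (rule bij_betw_nth_element[OF inf fin]) (use that in auto)
qed

lemma dini_zero_sq_bij: "bij_betw (\<lambda>n. (dini_zero \<nu> n)\<^sup>2) {1..} Z"
  using bij_betw_trans[OF dini_zero_bij sqrt_image_Z] by (simp add: o_def)

lemma dini_zero_1: "dini_zero \<nu> 1 > 0" "(dini_zero \<nu> 1)\<^sup>2 \<in> Z"
  "x \<in> Z \<Longrightarrow> (dini_zero \<nu> 1)\<^sup>2 \<le> x"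
proof -
  show pos: "dini_zero \<nu> 1 > 0" using bij_betwE[OF dini_zero_bij] by auto
  show "(dini_zero \<nu> 1)\<^sup>2 \<in> Z" using bij_betwE[OF dini_zero_sq_bij] by auto
  show "(dini_zero \<nu> 1)\<^sup>2 \<le> x" if "x \<in> Z"
  proof -
    have x: "x > 0" "F x = 0" using that F_zero_pos by auto
    have "dini_zero \<nu> 1 \<le> sqrt x"
      by (rule dini_zero_1_le) (use x dini_eq_0_iff[of "sqrt x"] in auto)
    then show ?thesis using pos x by (metis less_imp_le power_mono real_sqrt_pow2)
  qed
qed

text \<open>Below the smallest zero all terms are positive, so the limit along initial segments is
  an unordered sum.\<close>

lemma F_log_deriv_has_sum:
  assumes "0 \<le> t" "t < (dini_zero \<nu> 1)\<^sup>2"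
  shows "((\<lambda>x. 1 / (x - t)) has_sum (- deriv F t / F t)) Z"
proof (rule has_sum_if_exhaustion_tendsto[OF _ finite_Z_le log_deriv_tendsto])
  show "1 / (x - t) \<ge> 0" if "x \<in> Z" for x using dini_zero_1(3)[OF that] assms by simp
  show "F t \<noteq> 0" using dini_zero_1(3)[of t] assms by auto
qed

lemma dini_spectrum:
  obtains w2 where "positive_spectrum Z ((dini_zero \<nu> 1)\<^sup>2) w2 (\<lambda>t. - deriv F t / F t)"
proof -
  let ?w1 = "(dini_zero \<nu> 1)\<^sup>2"
  obtain z where z: "z \<in> Z" "z \<noteq> ?w1"
    using infinite_Z by (metis finite.simps insertI1 subsetI subset_singletonD singletonI)
  \<comment> \<open>Only finitely many zeros lie below any other zero \<open>z\<close>, so the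
    second smallest zero is a minimum over a finite set.\<close>
  define M where "M = {x \<in> Z. x \<le> z} - {?w1}"
  have M: "finite M" "M \<noteq> {}" using finite_Z_le[of z] z by (auto simp: M_def)
  have mM: "Min M \<in> M" using M by simp
  have "positive_spectrum Z ?w1 (Min M) (\<lambda>t. - deriv F t / F t)"
  proof
    show "?w1 < Min M" using mM dini_zero_1(3)[of "Min M"] by (auto simp: M_def)
    show "Min M \<in> Z" using mM by (auto simp: M_def)
    show "Min M \<le> x" if "x \<in> Z" "x \<noteq> ?w1" for x
    proof (cases "x \<le> z")
      case True
      then show ?thesis using that M by (intro Min_le) (auto simp: M_def)
    next
      case False
      then show ?thesis using mM by (auto simp: M_def)
    qed
  qed (use dini_zero_1 F_log_deriv_has_sum in auto)
  then show ?thesis using that by blast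
qed

lemma dini_rayleigh_eq: "dini_rayleigh (2 * m) \<nu> = (\<Sum>\<^sub>\<infinity>x\<in>Z. 1 / x ^ m)"
  using infsum_reindex_bij_betw[OF dini_zero_sq_bij, of "\<lambda>x. 1 / x ^ m"]
  by (simp add: dini_rayleigh_def power_mult)

text \<open>Together with \<open>\<eta>_1\<close> this evaluates the Rayleigh function of exponent
  2.\<close>

lemma F_log_deriv_0: "- deriv F 0 / F 0 = 3 / (4 * (\<nu> + 1))"
proof -
  have "deriv F (0 :: real) = (1 - 2 * \<nu>) * diffs (bessel_coeff \<nu>) 0 - bessel_coeff \<nu> 0 / 2"
    using DERIV_imp_deriv[OF F_deriv[of "0 :: real"]] by (simp add: power_series_0)
  then show ?thesis using nu by (simp add: F_0 diffs_def bessel_coeff_def field_simps)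
qed

end

section \<open>The two-sided bound and its sharpness\<close>

theorem theorem11:
  fixes \<nu> :: real and n :: nat
  assumes "\<nu> > - 1" and "n \<ge> 1"
  shows
    "(\<forall>x. 0 < \<bar>x\<bar> \<and> \<bar>x\<bar> < dini_zero \<nu> 1 \<longrightarrow>
        (dini_R \<nu> n x + 4 / 3 * (\<nu> + 1) * dini_a \<nu> n * x ^ (2 * n + 2)) / ((dini_zero \<nu> 1)\<^sup>2 - x\<^sup>2)
          < - (2 * (\<nu> + 1) / (3 * x)) * (deriv (dini_normalized \<nu>) x / dini_normalized \<nu> x) \<and>
        - (2 * (\<nu> + 1) / (3 * x)) * (deriv (dini_normalized \<nu>) x / dini_normalized \<nu> x)
          < (dini_R \<nu> n x + 4 / 3 * (\<nu> + 1) * dini_b \<nu> n * x ^ (2 * n + 2)) / ((dini_zero \<nu> 1)\<^sup>2 - x\<^sup>2)) \<and>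
     (\<forall>a'. a' > dini_a \<nu> n \<longrightarrow>
        \<not> (\<forall>x. 0 < \<bar>x\<bar> \<and> \<bar>x\<bar> < dini_zero \<nu> 1 \<longrightarrow>
              (dini_R \<nu> n x + 4 / 3 * (\<nu> + 1) * a' * x ^ (2 * n + 2)) / ((dini_zero \<nu> 1)\<^sup>2 - x\<^sup>2)
                < - (2 * (\<nu> + 1) / (3 * x)) * (deriv (dini_normalized \<nu>) x / dini_normalized \<nu> x))) \<and>
     (\<forall>b'. b' < dini_b \<nu> n \<longrightarrow>
        \<not> (\<forall>x. 0 < \<bar>x\<bar> \<and> \<bar>x\<bar> < dini_zero \<nu> 1 \<longrightarrow>
              - (2 * (\<nu> + 1) / (3 * x)) * (deriv (dini_normalized \<nu>) x / dini_normalized \<nu> x)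
                < (dini_R \<nu> n x + 4 / 3 * (\<nu> + 1) * b' * x ^ (2 * n + 2)) / ((dini_zero \<nu> 1)\<^sup>2 - x\<^sup>2)))"
proof -
  note nu = assms(1)
  define \<alpha> where "\<alpha> = dini_zero \<nu> 1"
  define F where "F = (power_series (dini_coeff \<nu>) :: real \<Rightarrow> real)"
  obtain w2 where "positive_spectrum {x. F x = 0} (\<alpha>\<^sup>2) w2 (\<lambda>t. - deriv F t / F t)"
    using dini_spectrum[OF nu] unfolding F_def \<alpha>_def by blast
  then interpret positive_spectrum "{x. F x = 0}" "\<alpha>\<^sup>2" w2 "\<lambda>t. - deriv F t / F t" .
  have \<alpha>: "\<alpha> > 0" using dini_zero_1(1)[OF nu] by (simp add: \<alpha>_def)
  \<comment> \<open>This factor turns -F'/F into the middle term. Its reciprocal is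
    \<open>\<eta> 1\<close>, so the constant term \<alpha>^2 of \<open>dini_R\<close> is K
    \<alpha>^2 times \<open>\<eta> 1\<close>.\<close>
  define K where "K = 4 / 3 * (\<nu> + 1)"
  have K: "K > 0" using nu by (simp add: K_def)
  have A: "dini_A \<nu> m = \<alpha>\<^sup>2 * \<eta> (m + 1) - \<eta> m" for m
  proof -
    have "dini_rayleigh (2 * m) \<nu> = \<eta> m" for m
      unfolding dini_rayleigh_eq[OF nu] \<eta>_def by (simp add: F_def)
    from this[of m] this[of "m + 1"] show ?thesis by (simp add: dini_A_def \<alpha>_def)
  qed
  have \<eta>1: "\<eta> 1 = 1 / K" using \<eta>_1 F_log_deriv_0[OF nu] nu by (simp add: F_def K_def)
  have b: "dini_b \<nu> n = - S n 0" using S_at_0[of n] by (simp add: dini_b_def A)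
  have a: "dini_a \<nu> n = - S n (\<alpha>\<^sup>2)"
  proof -
    have "3 * \<alpha>\<^sup>2 / (4 * (\<nu> + 1)) = \<alpha>\<^sup>2 * \<eta> 1" unfolding \<eta>1 K_def using nu by (simp add: field_simps)
    moreover have "\<alpha> ^ (2 * n + 2) = (\<alpha>\<^sup>2) ^ (n + 1)"
      by (simp only: power_mult[symmetric] distrib_left mult_1_right)
    ultimately have "1 - 3 * \<alpha>\<^sup>2 / (4 * (\<nu> + 1)) - (\<Sum>m=1..n. dini_A \<nu> m * \<alpha> ^ (2 * m))
        = - (\<alpha> ^ (2 * n + 2) * S n (\<alpha>\<^sup>2))"
      using S_at_w1[of n] by (simp only: A power_mult)
    then show ?thesis unfolding dini_a_def \<alpha>_def[symmetric] using \<alpha> by simp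
  qed
  have mid: "- (2 * (\<nu> + 1) / (3 * x)) * (deriv (dini_normalized \<nu>) x / dini_normalized \<nu> x)
      = K * (- deriv F (x\<^sup>2) / F (x\<^sup>2))" if "x \<noteq> 0" for x
  proof -
    have "- (2 * (\<nu> + 1) / (3 * x)) * (2 * x * q) = K * (- q)" for q
      using that by (simp add: K_def field_simps)
    from this[of "deriv F (x\<^sup>2) / F (x\<^sup>2)"] show ?thesis
      unfolding dini_normalized_log_deriv[OF nu] F_def[symmetric] by simp
  qed
  \<comment> \<open>For an arbitrary constant \<open>k\<close> the bound exceeds the middle term by
    a positive factor times S(x^2) + k. All the claims thus reduce to the sign of this sum.\<close>
  have key: "(dini_R \<nu> n x + 4 / 3 * (\<nu> + 1) * k * x ^ (2 * n + 2)) / ((dini_zero \<nu> 1)\<^sup>2 - x\<^sup>2)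
      = - (2 * (\<nu> + 1) / (3 * x)) * (deriv (dini_normalized \<nu>) x / dini_normalized \<nu> x)
        + K * x ^ (2 * n + 2) / (\<alpha>\<^sup>2 - x\<^sup>2) * (S n (x\<^sup>2) + k)"
    and pos: "K * x ^ (2 * n + 2) / (\<alpha>\<^sup>2 - x\<^sup>2) > 0"
    and range: "0 < x\<^sup>2" "x\<^sup>2 < \<alpha>\<^sup>2"
    if x: "0 < \<bar>x\<bar>" "\<bar>x\<bar> < dini_zero \<nu> 1" for x k
  proof -
    show range: "0 < x\<^sup>2" "x\<^sup>2 < \<alpha>\<^sup>2"
      using x[folded \<alpha>_def] \<alpha> power_strict_mono[of "\<bar>x\<bar>" \<alpha> 2] by auto
    have even: "x ^ (2 * n + 2) = (x\<^sup>2) ^ (n + 1)"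
      by (simp only: power_mult[symmetric] distrib_left mult_1_right)
    show "K * x ^ (2 * n + 2) / (\<alpha>\<^sup>2 - x\<^sup>2) > 0"
      unfolding even by (intro divide_pos_pos mult_pos_pos zero_less_power K range(1)) (use range(2) in simp)
    have "dini_R \<nu> n x = K * (\<alpha>\<^sup>2 * \<eta> 1 + (\<Sum>m=1..n. dini_A \<nu> m * (x\<^sup>2) ^ m))"
      unfolding \<eta>1 dini_R_def \<alpha>_def[symmetric] power_mult using K by (simp add: distrib_left K_def)
    also have "\<dots> = K * ((\<alpha>\<^sup>2 - x\<^sup>2) * (- deriv F (x\<^sup>2) / F (x\<^sup>2)) + x ^ (2 * n + 2) * S n (x\<^sup>2))"
      using G_expansion[of "x\<^sup>2" n] range unfolding even by (simp only: A) simp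
    finally have R: "dini_R \<nu> n x = \<dots>" .
    have split: "(K * (d * g + p * s) + K * k * p) / d = K * g + K * p / d * (s + k)"
      if "d \<noteq> 0" for d g p s :: real
      using that by (simp add: field_simps)
    show "(dini_R \<nu> n x + 4 / 3 * (\<nu> + 1) * k * x ^ (2 * n + 2)) / ((dini_zero \<nu> 1)\<^sup>2 - x\<^sup>2)
      = - (2 * (\<nu> + 1) / (3 * x)) * (deriv (dini_normalized \<nu>) x / dini_normalized \<nu> x)
        + K * x ^ (2 * n + 2) / (\<alpha>\<^sup>2 - x\<^sup>2) * (S n (x\<^sup>2) + k)"
      unfolding mid[of x, OF x(1)[unfolded zero_less_abs_iff]] R \<alpha>_def[symmetric] K_def[symmetric]
      by (rule split) (use range in simp)
  qed
  have sqrt_range: "0 < \<bar>sqrt t\<bar>" "\<bar>sqrt t\<bar> < dini_zero \<nu> 1" "(sqrt t)\<^sup>2 = t" if "0 < t" "t < \<alpha>\<^sup>2" for t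
    unfolding \<alpha>_def[symmetric] using that \<alpha> real_sqrt_less_mono[OF that(2)] by auto
  show ?thesis
  proof (intro conjI allI impI)
    fix x assume x: "0 < \<bar>x\<bar> \<and> \<bar>x\<bar> < dini_zero \<nu> 1"
    then have x: "0 < \<bar>x\<bar>" "\<bar>x\<bar> < dini_zero \<nu> 1" by auto
    have "S n (x\<^sup>2) + dini_a \<nu> n < 0" "S n (x\<^sup>2) + dini_b \<nu> n > 0"
      using S_strict_mono[of "x\<^sup>2" "\<alpha>\<^sup>2" n] S_strict_mono[of 0 "x\<^sup>2" n] range[OF x] by (auto simp: a b)
    then show "(dini_R \<nu> n x + 4 / 3 * (\<nu> + 1) * dini_a \<nu> n * x ^ (2 * n + 2)) / ((dini_zero \<nu> 1)\<^sup>2 - x\<^sup>2)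
          < - (2 * (\<nu> + 1) / (3 * x)) * (deriv (dini_normalized \<nu>) x / dini_normalized \<nu> x)"
       "- (2 * (\<nu> + 1) / (3 * x)) * (deriv (dini_normalized \<nu>) x / dini_normalized \<nu> x)
          < (dini_R \<nu> n x + 4 / 3 * (\<nu> + 1) * dini_b \<nu> n * x ^ (2 * n + 2)) / ((dini_zero \<nu> 1)\<^sup>2 - x\<^sup>2)"
      unfolding key[OF x] using mult_pos_neg[OF pos[OF x]] mult_pos_pos[OF pos[OF x]] by simp_all
  next
    fix a' assume a': "a' > dini_a \<nu> n"
    define C where "C = \<eta> (n + 1) / (w2 - \<alpha>\<^sup>2)"
    have C: "C \<ge> 0"
      unfolding C_def using w2 \<eta>_nonneg by (intro divide_nonneg_nonneg) auto
    \<comment> \<open>The first bound keeps \<alpha>^2 - d positive; the second gives d C <= a' +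
      S(\<alpha>^2), so that S + a' is still nonnegative at \<alpha>^2 - d by
      \<open>S_ge_near_w1\<close>. The denominator C + 1 is positive even if C = 0.\<close>
    define d where "d = min (\<alpha>\<^sup>2 / 2) ((a' + S n (\<alpha>\<^sup>2)) / (C + 1))"
    have d: "d > 0" "d < \<alpha>\<^sup>2" using \<alpha> a' C by (auto simp: d_def a min_def field_simps intro!: divide_pos_pos)
    have "d \<le> (a' + S n (\<alpha>\<^sup>2)) / (C + 1)" by (simp add: d_def)
    then have "d * C + d \<le> a' + S n (\<alpha>\<^sup>2)" using C by (simp add: pos_le_divide_eq algebra_simps)
    then have "d * C \<le> a' + S n (\<alpha>\<^sup>2)" using d by simp
    moreover have "S n (\<alpha>\<^sup>2 - d) \<ge> S n (\<alpha>\<^sup>2) - d * C" using S_ge_near_w1[of "\<alpha>\<^sup>2 - d" n] d by (simp add: C_def)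
    ultimately have le: "S n (\<alpha>\<^sup>2 - d) + a' \<ge> 0" by simp
    have t: "0 < \<alpha>\<^sup>2 - d" "\<alpha>\<^sup>2 - d < \<alpha>\<^sup>2" using d by auto
    define x where "x = sqrt (\<alpha>\<^sup>2 - d)"
    have x: "0 < \<bar>x\<bar>" "\<bar>x\<bar> < dini_zero \<nu> 1" "x\<^sup>2 = \<alpha>\<^sup>2 - d" using sqrt_range[OF t] by (simp_all add: x_def)
    show "\<not> (\<forall>x. 0 < \<bar>x\<bar> \<and> \<bar>x\<bar> < dini_zero \<nu> 1 \<longrightarrow>
              (dini_R \<nu> n x + 4 / 3 * (\<nu> + 1) * a' * x ^ (2 * n + 2)) / ((dini_zero \<nu> 1)\<^sup>2 - x\<^sup>2)
                < - (2 * (\<nu> + 1) / (3 * x)) * (deriv (dini_normalized \<nu>) x / dini_normalized \<nu> x))"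
      unfolding not_all
      using key[OF x(1,2), of a'] mult_nonneg_nonneg[OF less_imp_le[OF pos[OF x(1,2)]] le] x
      by (intro exI[of _ x]) simp
  next
    fix b' assume b': "b' < dini_b \<nu> n"
    define C where "C = \<eta> (n + 2)"
    have C: "C \<ge> 0"
      unfolding C_def by (rule \<eta>_nonneg)
    \<comment> \<open>The same choice at the other end: d C <= - b' - S(0), so that S + b' is still
      nonpositive at \<open>d\<close> by \<open>S_le_near_0\<close>.\<close>
    define d where "d = min (\<alpha>\<^sup>2 / 2) ((- b' - S n 0) / (C + 1))"
    have d: "d > 0" "d < \<alpha>\<^sup>2" using \<alpha> b' C by (auto simp: d_def b min_def field_simps intro!: divide_pos_pos)
    have "d \<le> (- b' - S n 0) / (C + 1)" by (simp add: d_def)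
    then have "d * C + d \<le> - b' - S n 0" using C by (simp add: pos_le_divide_eq algebra_simps)
    then have "d * C \<le> - b' - S n 0" using d by simp
    moreover have "S n d \<le> S n 0 + d * C" using S_le_near_0[of d n] d by (simp add: C_def)
    ultimately have le: "S n d + b' \<le> 0" by simp
    define x where "x = sqrt d"
    have x: "0 < \<bar>x\<bar>" "\<bar>x\<bar> < dini_zero \<nu> 1" "x\<^sup>2 = d" using sqrt_range[OF d] by (simp_all add: x_def)
    show "\<not> (\<forall>x. 0 < \<bar>x\<bar> \<and> \<bar>x\<bar> < dini_zero \<nu> 1 \<longrightarrow>
              - (2 * (\<nu> + 1) / (3 * x)) * (deriv (dini_normalized \<nu>) x / dini_normalized \<nu> x)
                < (dini_R \<nu> n x + 4 / 3 * (\<nu> + 1) * b' * x ^ (2 * n + 2)) / ((dini_zero \<nu> 1)\<^sup>2 - x\<^sup>2))"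
      unfolding not_all
      using key[OF x(1,2), of b'] mult_nonneg_nonpos[OF less_imp_le[OF pos[OF x(1,2)]] le] x
      by (intro exI[of _ x]) simp
  qed
qed

end
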